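(* Let $G$ be a countable commutative semigroup and let $$\Lambda_t=\left\{(m,\vec F,c)\;:\; m\in\mathbb{N},\ c\text{ is in the center of }\mathrm{End}(G),\ \vec F=(F_1,\dots,F_m),\ F_j\subset\mathrm{Hom}(G^j,G)\text{ finite for all } j\right\}.$$ Assume that $\Lambda_t$ is countable. Then for any finite partition of a $\Lambda_t$-system, one of the cells in the partition is still a $\Lambda_t$-system.
   Context: $\mathbb{N}=\{1,2,\dots\}$; semigroups are written additively. $\mathrm{Hom}(H,G)$ is the set of semigroup homomorphisms $H\to G$ and $\mathrm{End}(G)=\mathrm{Hom}(G,G)$, a semigroup under composition. A shape in $G$ is a triple $\lambda=(m,\vec F,c)$ where $m\in\mathbb{N}$, $c:G\to G$ is a homomorphism, and $\vec F=(F_1,\dots,F_m)$ is an $m$-tuple in which each $F_j$ is a finite set of functions from $G^j$ to $G$; for $\mathbf{s}=(s_0,\dots,s_m)\in G^{m+1}$, $$D(\lambda;\mathbf{s})=\{c(s_0)\}\cup\bigcup_{j=1}^m\{f(s_0,\dots,s_{j-1})+c(s_j):f\in F_j\}.$$ For a countable set of shapes $\Lambda$, a set $A\subset G$ is a $\Lambda$-system if for every shape $\lambda=(m,\vec F,c)\in\Lambda$ there exists $\mathbf{s}(\lambda)\in G^{m+1}$ such that: (i) $D(\lambda_1;\mathbf{s}(\lambda_1))\cap D(\lambda_2;\mathbf{s}(\lambda_2))=\emptyset$ whenever $\lambda_1\neq\lambda_2$ are in $\Lambda$; (ii) for every non-empty finite $\alpha\subset\Lambda$, $\sum_{\lambda\in\alpha}D(\lambda;\mathbf{s}(\lambda))\subset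 A$, where $\sum_iA_i$ denotes the set of all sums $\sum_i a_i$ with $a_i\in A_i$. *)

theory Defs
  imports "HOL-Library.Disjoint_Sets" "HOL-Library.FuncSet" "HOL-Library.Countable_Set"
begin

text \<open>The semigroup $G$ is a type of class \<^class>\<open>ab_semigroup_add\<close>. The power $G^j$ is the set of
  lists of length $j$ with componentwise addition.\<close>

definition pow_carrier :: "nat \<Rightarrow> 'a list set" where
  "pow_carrier j = {xs. length xs = j}"

definition pow_add :: "'a::ab_semigroup_add list \<Rightarrow> 'a list \<Rightarrow> 'a list" where
  "pow_add xs ys = map2 (+) xs ys"

text \<open>Maps with a proper subset of a type as domain are taken to be extensional, so that equality
  of HOL functions is equality of maps on that domain. This matters for the cardinality of sets of
  shapes and for the condition that two shapes are distinct.\<close>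

definition Hom :: "'h set \<Rightarrow> ('h \<Rightarrow> 'h \<Rightarrow> 'h) \<Rightarrow> ('h \<Rightarrow> 'a::ab_semigroup_add) set" where
  "Hom H add = {f \<in> H \<rightarrow>\<^sub>E UNIV. \<forall>x\<in>H. \<forall>y\<in>H. f (add x y) = f x + f y}"

definition End :: "('a::ab_semigroup_add \<Rightarrow> 'a) set" where
  "End = Hom UNIV (+)"

definition center_End :: "('a::ab_semigroup_add \<Rightarrow> 'a) set" where
  "center_End = {c \<in> End. \<forall>g\<in>End. c \<circ> g = g \<circ> c}"

text \<open>In a shape $(m, \vec F, c)$ the tuple $\vec F = (F_1, \dots, F_m)$ is a list, so $F_j$ is the
  list entry with index $j - 1$; the tuple $(s_0, \dots, s_m)$ is a list of length $m + 1$.\<close>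

type_synonym 'a shape = "nat \<times> ('a list \<Rightarrow> 'a) set list \<times> ('a \<Rightarrow> 'a)"

definition shapes :: "'a::ab_semigroup_add shape set" where
  "shapes = {(m, F, c). m \<ge> 1 \<and> c \<in> End \<and> length F = m \<and>
     (\<forall>j\<in>{1..m}. finite (F ! (j - 1)) \<and> F ! (j - 1) \<subseteq> (pow_carrier j \<rightarrow>\<^sub>E UNIV))}"

definition D :: "'a::ab_semigroup_add shape \<Rightarrow> 'a list \<Rightarrow> 'a set" where
  "D l s = (case l of (m, F, c) \<Rightarrow>
     {c (s ! 0)} \<union> (\<Union>j\<in>{1..m}. {f (take j s) + c (s ! j) |f. f \<in> F ! (j - 1)}))"

text \<open>A semigroup need not have a zero, so \<^const>\<open>sum\<close> is not available. The sum over a non-empty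
  finite set is computed by folding in $G$ with a neutral element \<^term>\<open>None\<close> adjoined; its value
  on the empty set and on infinite sets is arbitrary.\<close>

definition nsum_step :: "('i \<Rightarrow> 'a::ab_semigroup_add) \<Rightarrow> 'i \<Rightarrow> 'a option \<Rightarrow> 'a option" where
  "nsum_step a i r = (case r of None \<Rightarrow> Some (a i) | Some x \<Rightarrow> Some (a i + x))"

definition nsum :: "('i \<Rightarrow> 'a::ab_semigroup_add) \<Rightarrow> 'i set \<Rightarrow> 'a" where
  "nsum a I = the (Finite_Set.fold (nsum_step a) None I)"

interpretation nsum: comp_fun_commute "nsum_step a"
  by standard (auto simp: nsum_step_def fun_eq_iff add_ac split: option.split)

lemma nsum_singleton [simp]: "nsum a {i} = a i"
  by (simp add: nsum_def nsum_step_def)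

lemma nsum_insert:
  assumes "finite I" "I \<noteq> {}" "i \<notin> I"
  shows "nsum a (insert i I) = a i + nsum a I"
proof -
  have "Finite_Set.fold (nsum_step a) None I \<noteq> None"
    using assms(1,2) by (induction I rule: finite_induct) (auto simp: nsum_step_def split: option.split)
  then show ?thesis
    using assms by (auto simp: nsum_def nsum_step_def)
qed

definition sum_sets :: "('i \<Rightarrow> 'a::ab_semigroup_add set) \<Rightarrow> 'i set \<Rightarrow> 'a set" where
  "sum_sets B I = {nsum a I |a. \<forall>i\<in>I. a i \<in> B i}"

definition is_system :: "'a::ab_semigroup_add shape set \<Rightarrow> 'a set \<Rightarrow> bool" where
  "is_system L A \<longleftrightarrow> (\<exists>s.
     (\<forall>l\<in>L. s l \<in> pow_carrier (fst l + 1)) \<and>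
     (\<forall>l1\<in>L. \<forall>l2\<in>L. l1 \<noteq> l2 \<longrightarrow> D l1 (s l1) \<inter> D l2 (s l2) = {}) \<and>
     (\<forall>I. finite I \<and> I \<noteq> {} \<and> I \<subseteq> L \<longrightarrow> sum_sets (\<lambda>l. D l (s l)) I \<subseteq> A))"

definition Lambda_t :: "'a::ab_semigroup_add shape set" where
  "Lambda_t = {(m, F, c). (m, F, c) \<in> shapes \<and> c \<in> center_End \<and>
     (\<forall>j\<in>{1..m}. F ! (j - 1) \<subseteq> Hom (pow_carrier j) pow_add)}"

end

theory Submission
  imports Defs "HOL-Library.Function_Algebras"
begin

text \<open>Call a set large if it contains a set \<open>D(\<lambda>; s)\<close> for every shape \<open>\<lambda>\<close>.
  By the Hales-Jewett theorem and Deuber's argument, largeness is partition regular, so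
  that there are ultrafilters all of whose members are large and which contain all sums over shapes
  outside any given finite set of the given system. Since the maps of a shape are
  homomorphisms, these ultrafilters form a closed subsemigroup of \<open>\<beta>G\<close>, and this subsemigroup has
  an idempotent. A member of the partition that belongs to the idempotent contains a system by the
  usual construction for idempotents. Disjointness needs a non-principal idempotent; the
  disjointness in the given system and the constant maps with idempotent value among the
  homomorphisms of a shape provide it.\<close>

section \<open>The Hales-Jewett theorem\<close>

text \<open>Two features of the setting shape the proof. The semigroup has neither a zero nor
  cancellation. So a neutral element is adjoined to mark absent summands, a bare term c(u_k) is
  obtained by substituting s_0 + s_(k+1) for u_k, and a central c is moved through a homomorphism of
  several variables only up to a summand added on both sides, which a term common to all letters
  then absorbs. Moreover, each substitution in Deuber's argument composes the coefficients c.
  Centrality keeps this under control: central maps commute with each other and pass through every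
  endomorphism. Partition regularity is proved in a uniform form: for finitely many points, a finite
  set of substitutions is fixed before the sequence and the colouring are given, so that largeness
  can be applied once to all the resulting points. A principal idempotent could only sit at some e
  with e + e = e. For such e the constant map e is a homomorphism, hence a point can be realised
  together with its translate by e, and this translate can be kept away from any finite set.\<close>

definition subst_word :: "'w \<Rightarrow> 'w option list \<Rightarrow> 'w list" where
  "subst_word a v = map (case_option a id) v"

definition words :: "'w set \<Rightarrow> nat \<Rightarrow> 'w list set" where
  "words W n = {w. set w \<subseteq> W \<and> length w = n}"

definition var_words :: "'w set \<Rightarrow> nat \<Rightarrow> 'w option list set" where
  "var_words W n = {v. length v = n \<and> None \<in> set v \<and> set v \<subseteq> insert None (Some ` W)}"

lemma subst_word_append [simp]: "subst_word a (v @ v') = subst_word a v @ subst_word a v'"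
  by (simp add: subst_word_def)

lemma subst_word_map_Some [simp]: "subst_word a (map Some w) = w"
  by (simp add: subst_word_def o_def)

lemma subst_word_in_words:
  assumes "v \<in> var_words W n" "a \<in> W"
  shows "subst_word a v \<in> words W n"
  using assms by (auto simp: words_def var_words_def subst_word_def)

lemma append_in_words: "x \<in> words W n \<Longrightarrow> y \<in> words W k \<Longrightarrow> x @ y \<in> words W (n + k)"
  by (auto simp: words_def)

lemma var_words_appendL:
  "v \<in> var_words W n \<Longrightarrow> w \<in> words W k \<Longrightarrow> v @ map Some w \<in> var_words W (n + k)"
  by (auto simp: words_def var_words_def)

lemma var_words_appendR:
  "w \<in> words W n \<Longrightarrow> v \<in> var_words W k \<Longrightarrow> map Some w @ v \<in> var_words W (n + k)"
  by (auto simp: words_def var_words_def)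

lemma var_words_append:
  "v \<in> var_words W n \<Longrightarrow> v' \<in> var_words W k \<Longrightarrow> v @ v' \<in> var_words W (n + k)"
  by (auto simp: var_words_def)

lemma words_mono: "W \<subseteq> W' \<Longrightarrow> w \<in> words W n \<Longrightarrow> w \<in> words W' n"
  by (auto simp: words_def)

lemma var_words_mono: "W \<subseteq> W' \<Longrightarrow> w \<in> var_words W n \<Longrightarrow> w \<in> var_words W' n"
  unfolding var_words_def by blast

lemma finite_words: "finite W \<Longrightarrow> finite (words W n)"
  by (simp add: words_def finite_lists_length_eq)

lemma finite_var_words: "finite W \<Longrightarrow> finite (var_words W n)"
  by (rule finite_subset[OF _ finite_words[of "insert None (Some ` W)" n]])
     (auto simp: words_def var_words_def)

definition hales_jewett :: "'w set \<Rightarrow> nat \<Rightarrow> nat \<Rightarrow> bool" where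
  "hales_jewett W r n \<longleftrightarrow> (\<forall>\<chi>::'w list \<Rightarrow> nat. (\<forall>w\<in>words W n. \<chi> w < r) \<longrightarrow>
     (\<exists>v\<in>var_words W n. \<exists>k. \<forall>a\<in>W. \<chi> (subst_word a v) = k))"

text \<open>Needed because the colours in the focusing step are themselves functions on
  words.\<close>

lemma hales_jewett_finite_range:
  assumes "hales_jewett W (card Q) n" "finite Q" "\<And>w. w \<in> words W n \<Longrightarrow> \<xi> w \<in> Q"
  shows "\<exists>v\<in>var_words W n. \<exists>k. \<forall>a\<in>W. \<xi> (subst_word a v) = k"
proof -
  obtain h where h: "bij_betw h Q {0..<card Q}"
    using ex_bij_betw_finite_nat[OF assms(2)] by blast
  have "\<forall>w\<in>words W n. (h \<circ> \<xi>) w < card Q"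
    using h assms(3) by (auto simp: bij_betw_def)
  then obtain v k where v: "v \<in> var_words W n" "\<forall>a\<in>W. (h \<circ> \<xi>) (subst_word a v) = k"
    using assms(1) unfolding hales_jewett_def by blast
  then have "\<forall>a\<in>W. \<forall>b\<in>W. \<xi> (subst_word a v) = \<xi> (subst_word b v)"
    using h assms(3) subst_word_in_words[OF v(1)]
    unfolding bij_betw_def inj_on_def by (metis comp_apply)
  then show ?thesis using v(1) by blast
qed

text \<open>Colour focusing: either there is a monochromatic line, or there are \<open>k\<close> lines that are
  monochromatic apart from the letter \<open>a\<close>, have distinct colours, and meet at \<open>a\<close>.\<close>

definition focused :: "'w set \<Rightarrow> 'w \<Rightarrow> nat \<Rightarrow> nat \<Rightarrow> nat \<Rightarrow> bool" where
  "focused W a r k n \<longleftrightarrow> (\<forall>\<chi>::'w list \<Rightarrow> nat. (\<forall>w\<in>words (insert a W) n. \<chi> w < r) \<longrightarrow>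
     (\<exists>v\<in>var_words (insert a W) n. \<exists>k. \<forall>b\<in>insert a W. \<chi> (subst_word b v) = k) \<or>
     (\<exists>V f col. f \<in> words (insert a W) n \<and> inj_on col {..<k} \<and>
       (\<forall>i<k. V i \<in> var_words (insert a W) n \<and> subst_word a (V i) = f \<and> col i < r \<and>
         (\<forall>b\<in>W. \<chi> (subst_word b (V i)) = col i))))"

text \<open>Words of length \<open>n2\<close> are coloured by the function they induce on words of
  length \<open>n\<close>. Hales-Jewett for the smaller alphabet \<open>W\<close> gives a line
  \<open>v2\<close> along which this function is constant on \<open>W\<close>. Lines focused for
  \<open>\<chi>'\<close> can then be prolonged by \<open>v2\<close>, and the old focus followed by
  \<open>v2\<close> is one more line.\<close>

lemma focused_Suc:
  fixes W :: "'w set"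
  assumes W: "finite W" "W \<noteq> {}" and IH: "\<And>r. \<exists>n. hales_jewett W r n"
    and k: "focused W a r k n"
  shows "\<exists>n. focused W a r (Suc k) n"
proof -
  define W' where "W' = insert a W"
  define Q :: "('w list \<Rightarrow> nat) set" where "Q = words W' n \<rightarrow>\<^sub>E {..<r}"
  have "finite Q" using W by (auto simp: Q_def W'_def intro!: finite_PiE finite_words)
  obtain n2 where n2: "hales_jewett W (card Q) n2" using IH by blast
  obtain b0 where b0: "b0 \<in> W" using W by blast
  have sub: "W \<subseteq> W'" by (auto simp: W'_def)
  have "focused W a r (Suc k) (n + n2)"
    unfolding focused_def W'_def[symmetric]
  proof (intro allI impI)
    fix \<chi> :: "'w list \<Rightarrow> nat"
    assume \<chi>: "\<forall>w\<in>words W' (n + n2). \<chi> w < r"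
    define \<xi> where "\<xi> y = restrict (\<lambda>x. \<chi> (x @ y)) (words W' n)" for y
    have "\<And>y. y \<in> words W n2 \<Longrightarrow> \<xi> y \<in> Q"
      using \<chi> append_in_words[OF _ words_mono[OF sub]] by (auto simp: Q_def \<xi>_def)
    from hales_jewett_finite_range[OF n2 \<open>finite Q\<close>, of \<xi>, OF this]
    obtain v2 \<kappa> where v2: "v2 \<in> var_words W n2" and "\<forall>b\<in>W. \<xi> (subst_word b v2) = \<kappa>" by blast
    then have \<kappa>: "\<chi> (x @ subst_word b v2) = \<kappa> x" if "b \<in> W" "x \<in> words W' n" for b x
      using that by (auto simp: \<xi>_def restrict_def fun_eq_iff split: if_splits)
    define y0 where "y0 = subst_word b0 v2"
    have y0: "y0 \<in> words W' n2"
      unfolding y0_def using words_mono[OF sub subst_word_in_words[OF v2 b0]] .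
    define \<chi>' where "\<chi>' x = \<chi> (x @ y0)" for x
    have \<chi>': "\<forall>w\<in>words W' n. \<chi>' w < r"
      using \<chi> append_in_words[OF _ y0] by (auto simp: \<chi>'_def)
    have \<kappa>': "\<chi> (x @ subst_word b v2) = \<chi>' x" if "b \<in> W" "x \<in> words W' n" for b x
      using \<kappa>[OF that] \<kappa>[OF b0 that(2)] by (simp add: \<chi>'_def y0_def)
    have mono_lift: "\<exists>v\<in>var_words W' (n + n2). \<exists>k. \<forall>b\<in>W'. \<chi> (subst_word b v) = k"
      if "v \<in> var_words W' n" "\<forall>b\<in>W'. \<chi>' (subst_word b v) = k" for v k
      using that var_words_appendL[OF that(1) y0]
      by (intro bexI[of _ "v @ map Some y0"]) (auto simp: \<chi>'_def)
    consider (mono) v k where "v \<in> var_words W' n" "\<forall>b\<in>W'. \<chi>' (subst_word b v) = k"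
      | (foc) V f col where "f \<in> words W' n" "inj_on col {..<k}"
         "\<forall>i<k. V i \<in> var_words W' n \<and> subst_word a (V i) = f \<and> col i < r \<and>
           (\<forall>b\<in>W. \<chi>' (subst_word b (V i)) = col i)"
      using k[unfolded focused_def, folded W'_def, rule_format, of \<chi>'] \<chi>' by blast
    then show "(\<exists>v\<in>var_words W' (n + n2). \<exists>k. \<forall>b\<in>W'. \<chi> (subst_word b v) = k) \<or>
       (\<exists>V f col. f \<in> words W' (n + n2) \<and> inj_on col {..<Suc k} \<and>
         (\<forall>i<Suc k. V i \<in> var_words W' (n + n2) \<and> subst_word a (V i) = f \<and> col i < r \<and>
           (\<forall>b\<in>W. \<chi> (subst_word b (V i)) = col i)))"
    proof cases
      case mono
      then show ?thesis using mono_lift by blast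
    next
      case foc
      show ?thesis
      proof (cases "\<exists>i<k. \<chi>' f = col i")
        \<comment> \<open>The focus has the colour of one of the lines, so that this line is
          monochromatic at \<open>a\<close> as well.\<close>
        case True
        then obtain i where "i < k" "\<chi>' f = col i" by blast
        then have "\<forall>b\<in>W'. \<chi>' (subst_word b (V i)) = col i" using foc(3) by (auto simp: W'_def)
        then show ?thesis using mono_lift foc(3) \<open>i < k\<close> by blast
      next
        case False
        \<comment> \<open>All these lines meet at \<open>f @ subst_word a v2\<close>. The one with
          index \<open>k\<close> varies only in its second part, and its colour
          \<open>\<chi>' f\<close> is new by the case assumption.\<close>
        define V' where "V' i = (if i < k then V i else map Some f) @ v2" for i
        define col' where "col' i = (if i < k then col i else \<chi>' f)" for i
        have v2': "v2 \<in> var_words W' n2" using var_words_mono[OF sub v2] .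
        have "f @ subst_word a v2 \<in> words W' (n + n2)"
          by (rule append_in_words[OF foc(1) subst_word_in_words[OF v2']]) (simp add: W'_def)
        moreover have "inj_on col' {..<Suc k}"
          using foc(2) False by (auto simp: inj_on_def col'_def)
        moreover have "V' i \<in> var_words W' (n + n2) \<and> subst_word a (V' i) = f @ subst_word a v2 \<and>
            col' i < r \<and> (\<forall>b\<in>W. \<chi> (subst_word b (V' i)) = col' i)" if "i < Suc k" for i
        proof (cases "i < k")
          case True
          have "\<chi> (subst_word b (V i) @ subst_word b v2) = col i" if "b \<in> W" for b
            using \<kappa>'[OF that, of "subst_word b (V i)"] foc(3) True that
              subst_word_in_words[of "V i" W' n b] sub by auto
          then show ?thesis using True foc(3) var_words_append[OF _ v2']
            by (auto simp: V'_def col'_def)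
        next
          case False
          then show ?thesis using foc(1) \<chi>' var_words_appendR[OF foc(1) v2'] \<kappa>'[OF _ foc(1)]
            by (auto simp: V'_def col'_def)
        qed
        ultimately show ?thesis by blast
      qed
    qed
  qed
  then show ?thesis by blast
qed

lemma hales_jewett_singleton:
  assumes "W \<subseteq> {a}"
  shows "hales_jewett W r 1"
  unfolding hales_jewett_def
proof (intro allI impI)
  fix \<chi> :: "'a list \<Rightarrow> nat"
  have "[None] \<in> var_words W 1" by (simp add: var_words_def)
  moreover have "\<forall>b\<in>W. \<chi> (subst_word b [None]) = \<chi> (subst_word a [None])" using assms by auto
  ultimately show "\<exists>v\<in>var_words W 1. \<exists>k. \<forall>a\<in>W. \<chi> (subst_word a v) = k" by blast
qed

text \<open>Induction on the alphabet for all numbers of colours at once, since focusing calls the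
  smaller alphabet with many more colours. With \<open>r\<close> focused lines every colour is
  taken, so the focus shares its colour with one of them.\<close>

theorem hales_jewett_exists:
  assumes "finite W"
  shows "\<exists>n. hales_jewett W r n"
  using assms
proof (induction W arbitrary: r rule: finite_induct)
  case empty
  show ?case by (rule exI, rule hales_jewett_singleton) simp
next
  case (insert a W)
  show ?case
  proof (cases "W = {}")
    case True
    show ?thesis by (rule exI, rule hales_jewett_singleton) (simp add: True)
  next
    case False
    have "\<exists>n. focused W a r k n" for k
    proof (induction k)
      case 0
      have "[] \<in> words (insert a W) 0" by (simp add: words_def)
      then have "focused W a r 0 0" unfolding focused_def by auto
      then show ?case ..
    next
      case (Suc k)
      then show ?case using focused_Suc[OF insert.hyps(1) False insert.IH] by blast
    qed
    then obtain n where n: "focused W a r r n" by blast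
    have "hales_jewett (insert a W) r n"
      unfolding hales_jewett_def
    proof (intro allI impI)
      fix \<chi> :: "'a list \<Rightarrow> nat"
      assume \<chi>: "\<forall>w\<in>words (insert a W) n. \<chi> w < r"
      consider (mono) "\<exists>v\<in>var_words (insert a W) n. \<exists>k. \<forall>b\<in>insert a W. \<chi> (subst_word b v) = k"
        | (foc) V f col where "f \<in> words (insert a W) n" "inj_on col {..<r}"
           "\<forall>i<r. V i \<in> var_words (insert a W) n \<and> subst_word a (V i) = f \<and> col i < r \<and>
             (\<forall>b\<in>W. \<chi> (subst_word b (V i)) = col i)"
        using n \<chi> unfolding focused_def by blast
      then show "\<exists>v\<in>var_words (insert a W) n. \<exists>k. \<forall>b\<in>insert a W. \<chi> (subst_word b v) = k"
      proof cases
        case foc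
        have "col ` {..<r} \<subseteq> {..<r}" using foc(3) by blast
        moreover have "card (col ` {..<r}) = card {..<r}" using foc(2) by (rule card_image)
        ultimately have "col ` {..<r} = {..<r}" by (intro card_subset_eq) simp_all
        moreover have "\<chi> f < r" using foc(1) \<chi> by blast
        ultimately obtain i where i: "i < r" "\<chi> f = col i" by (metis imageE lessThan_iff)
        then have "\<forall>b\<in>insert a W. \<chi> (subst_word b (V i)) = col i" using foc(3) by simp
        then show ?thesis using foc(3) i(1) by blast
      qed
    qed
    then show ?thesis ..
  qed
qed

section \<open>Homomorphisms on finite powers\<close>

text \<open>The neutral element is new even if \<open>'a\<close> has a zero: the value 0 then
  signals an absent summand, and a sum vanishes only if all its summands are absent.\<close>

datatype 'a adj0 = Zero_adj0 | Elt (elt: 'a)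

instantiation adj0 :: (ab_semigroup_add) comm_monoid_add
begin

definition zero_adj0 :: "'a adj0" where
  "zero_adj0 = Zero_adj0"

definition plus_adj0 :: "'a adj0 \<Rightarrow> 'a adj0 \<Rightarrow> 'a adj0" where
  "x + y = (case x of Zero_adj0 \<Rightarrow> y | Elt a \<Rightarrow> (case y of Zero_adj0 \<Rightarrow> x | Elt b \<Rightarrow> Elt (a + b)))"

instance
  by standard (auto simp: zero_adj0_def plus_adj0_def add_ac split: adj0.splits)

end

lemma Elt_add: "Elt (a + b) = Elt a + Elt b"
  by (simp add: plus_adj0_def)

lemma Elt_neq_0 [simp]: "Elt a \<noteq> 0" "0 \<noteq> Elt a"
  by (simp_all add: zero_adj0_def)

lemma Elt_elt [simp]: "x \<noteq> 0 \<Longrightarrow> Elt (elt x) = x"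
  by (cases x) (simp_all add: zero_adj0_def)

lemma adj0_add_eq_0 [simp]: "x + y = 0 \<longleftrightarrow> x = 0 \<and> y = (0 :: 'a::ab_semigroup_add adj0)"
  by (auto simp: zero_adj0_def plus_adj0_def split: adj0.splits)

lemma adj0_sum_eq_0:
  "finite I \<Longrightarrow> (\<Sum>i\<in>I. f i) = 0 \<longleftrightarrow> (\<forall>i\<in>I. f i = (0 :: 'a::ab_semigroup_add adj0))"
  by (induction I rule: finite_induct) auto

section \<open>Additive maps and central endomorphisms\<close>

definition add_hom :: "('b::plus \<Rightarrow> 'c::plus) \<Rightarrow> bool" where
  "add_hom f \<longleftrightarrow> (\<forall>x y. f (x + y) = f x + f y)"

lemma add_homD: "add_hom f \<Longrightarrow> f (x + y) = f x + f y"
  by (simp add: add_hom_def)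

lemma map_adj0_0 [simp]: "map_adj0 c 0 = 0"
  by (simp add: zero_adj0_def)

lemma map_adj0_add: "add_hom c \<Longrightarrow> map_adj0 c (x + y) = map_adj0 c x + map_adj0 c y"
  by (cases x; cases y) (auto simp: plus_adj0_def add_hom_def)

lemma map_adj0_sum: "add_hom c \<Longrightarrow> map_adj0 c (\<Sum>i\<in>I. f i) = (\<Sum>i\<in>I. map_adj0 c (f i))"
  by (induction I rule: infinite_finite_induct) (auto simp: map_adj0_add)

lemma mem_End_iff: "f \<in> End \<longleftrightarrow> add_hom f"
  by (simp add: End_def Hom_def add_hom_def)

lemma center_add_hom: "c \<in> center_End \<Longrightarrow> add_hom c"
  by (simp add: center_End_def mem_End_iff)

lemma center_commute: "c \<in> center_End \<Longrightarrow> add_hom g \<Longrightarrow> c (g x) = g (c x)"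
  by (simp add: center_End_def mem_End_iff fun_eq_iff)

lemma center_comp:
  assumes "c \<in> center_End" "d \<in> center_End"
  shows "c \<circ> d \<in> center_End"
proof -
  have "add_hom (c \<circ> d)"
    using assms[THEN center_add_hom] by (simp add: add_hom_def)
  moreover have "c \<circ> d \<circ> g = g \<circ> (c \<circ> d)" if "g \<in> End" for g
    using assms that unfolding center_End_def by (metis (mono_tags, lifting) comp_assoc mem_Collect_eq)
  ultimately show ?thesis by (simp add: center_End_def mem_End_iff)
qed

text \<open>The maps in \<open>prefix_hom k\<close> are the homomorphisms \<open>G\<^sup>k \<rightarrow> G\<close>, read as functions of a whole
  sequence, together with the constant map \<open>0\<close>. The latter stands for an absent summand.\<close>

definition prefix_hom :: "nat \<Rightarrow> ((nat \<Rightarrow> 'a::ab_semigroup_add) \<Rightarrow> 'a adj0) set" where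
  "prefix_hom k = {\<phi>. add_hom \<phi> \<and> (\<forall>u v. (\<forall>i<k. u i = v i) \<longrightarrow> \<phi> u = \<phi> v) \<and>
     ((\<forall>u. \<phi> u = 0) \<or> (\<forall>u. \<phi> u \<noteq> 0))}"

text \<open>The elements of a set \<open>D\<close>, read as functions of the unknown sequence.
  Unlike in \<open>D\<close>, the homomorphism may be absent at every \<open>k\<close>, and at
  \<open>k = 0\<close> it may be a constant idempotent.\<close>

definition points :: "nat \<Rightarrow> ('a \<Rightarrow> 'a) \<Rightarrow> ((nat \<Rightarrow> 'a::ab_semigroup_add) \<Rightarrow> 'a adj0) set" where
  "points m c = {\<lambda>u. \<phi> u + Elt (c (u k)) |k \<phi>. k < m \<and> \<phi> \<in> prefix_hom k}"

lemma prefix_hom_add_hom: "\<phi> \<in> prefix_hom k \<Longrightarrow> add_hom \<phi>"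
  by (simp add: prefix_hom_def)

lemma prefix_hom_cong: "\<phi> \<in> prefix_hom k \<Longrightarrow> (\<And>i. i < k \<Longrightarrow> u i = v i) \<Longrightarrow> \<phi> u = \<phi> v"
  by (auto simp: prefix_hom_def)

lemma prefix_hom_0: "(\<lambda>_. 0) \<in> prefix_hom k"
  by (simp add: prefix_hom_def add_hom_def)

lemma prefix_hom_add:
  assumes "\<phi> \<in> prefix_hom k" "\<psi> \<in> prefix_hom k"
  shows "(\<lambda>u. \<phi> u + \<psi> u) \<in> prefix_hom k"
proof -
  have "add_hom (\<lambda>u. \<phi> u + \<psi> u)"
    using assms by (simp add: prefix_hom_def add_hom_def add_ac)
  moreover have "\<phi> u + \<psi> u = \<phi> v + \<psi> v" if "\<forall>i<k. u i = v i" for u v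
    using prefix_hom_cong[OF assms(1)] prefix_hom_cong[OF assms(2)] that by metis
  moreover have "(\<forall>u. \<phi> u + \<psi> u = 0) \<or> (\<forall>u. \<phi> u + \<psi> u \<noteq> 0)"
    using assms unfolding prefix_hom_def adj0_add_eq_0 by blast
  ultimately show ?thesis
    unfolding prefix_hom_def by blast
qed

lemma prefix_hom_sum:
  "(\<And>i. i \<in> I \<Longrightarrow> \<phi> i \<in> prefix_hom k) \<Longrightarrow> (\<lambda>u. \<Sum>i\<in>I. \<phi> i u) \<in> prefix_hom k"
  by (induction I rule: infinite_finite_induct) (auto simp: prefix_hom_0 intro!: prefix_hom_add)

lemma prefix_hom_subst:
  assumes "\<phi> \<in> prefix_hom k" "add_hom \<sigma>"
    and "\<And>u v j. \<forall>i<l. u i = v i \<Longrightarrow> j < k \<Longrightarrow> \<sigma> u j = \<sigma> v j"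
  shows "(\<lambda>u. \<phi> (\<sigma> u)) \<in> prefix_hom l"
proof -
  have "\<phi> (\<sigma> u) = \<phi> (\<sigma> v)" if "\<forall>i<l. u i = v i" for u v
    by (rule prefix_hom_cong[OF assms(1)]) (rule assms(3)[OF that])
  then show ?thesis using assms(1,2) by (auto simp: prefix_hom_def add_hom_def)
qed

lemma prefix_hom_coord: "i < k \<Longrightarrow> add_hom c \<Longrightarrow> (\<lambda>u. Elt (c (u i))) \<in> prefix_hom k"
  by (auto simp: prefix_hom_def add_hom_def Elt_add)

lemma pointsI: "k < m \<Longrightarrow> \<phi> \<in> prefix_hom k \<Longrightarrow> (\<lambda>u. \<phi> u + Elt (c (u k))) \<in> points m c"
  by (auto simp: points_def)

lemma pointsE:
  assumes "\<pi> \<in> points m c"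
  obtains k \<phi> where "k < m" "\<phi> \<in> prefix_hom k" "\<pi> = (\<lambda>u. \<phi> u + Elt (c (u k)))"
  using assms by (auto simp: points_def)

lemma points_mono: "m \<le> n \<Longrightarrow> points m c \<subseteq> points n c"
  unfolding points_def using order_less_le_trans by blast

lemma points_add_hom: "\<pi> \<in> points m c \<Longrightarrow> add_hom c \<Longrightarrow> add_hom \<pi>"
  by (elim pointsE) (auto simp: add_hom_def prefix_hom_def Elt_add add_ac)

lemma points_neq_0: "\<pi> \<in> points m c \<Longrightarrow> \<pi> u \<noteq> 0"
  by (elim pointsE) auto

text \<open>Unless \<open>\<phi>\<close> is absent, \<open>\<phi>\<close> after
  \<open>\<psi>\<close> is an endomorphism of G, and \<open>c\<close> is central.\<close>

lemma prefix_hom_diag_commute: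
  assumes "\<phi> \<in> prefix_hom k" "c \<in> center_End" "add_hom \<psi>"
  shows "map_adj0 c (\<phi> (\<psi> x)) = \<phi> (\<psi> (c x))"
proof (cases "\<forall>u. \<phi> u = 0")
  case False
  then have *: "\<phi> u \<noteq> 0" for u using assms(1) by (auto simp: prefix_hom_def)
  define g where "g x = elt (\<phi> (\<psi> x))" for x
  have g: "Elt (g x) = \<phi> (\<psi> x)" for x by (simp add: g_def *)
  have "Elt (g (x + y)) = Elt (g x + g y)" for x y
    using assms(1,3) unfolding Elt_add g by (simp add: prefix_hom_def add_hom_def)
  then have "add_hom g" by (simp add: add_hom_def)
  then have "c (g x) = g (c x)" using assms(2) center_commute by blast
  then show ?thesis by (metis g adj0.map(2))
qed auto

primrec psum :: "(nat \<Rightarrow> 'a::ab_semigroup_add) \<Rightarrow> nat \<Rightarrow> 'a" where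
  "psum u 0 = u 0"
| "psum u (Suc k) = psum u k + u (Suc k)"

lemma psum_add: "psum (u + v) k = psum u k + psum v k"
  by (induction k) (simp_all add: add_ac)

lemma psum_cong: "(\<And>i. i \<le> k \<Longrightarrow> u i = v i) \<Longrightarrow> psum u k = psum v k"
  by (induction k) simp_all

text \<open>A central \<open>c\<close> commutes with \<open>\<phi>\<close> on the sequences obtained from a single element of \<open>G\<close> by a
  homomorphism. Since \<open>G\<close> need not have a zero, a general \<open>u\<close> is a sum of such sequences only
  after adding a constant sequence; hence the additional summand on both sides.\<close>

lemma prefix_hom_center_commute:
  fixes \<phi> :: "(nat \<Rightarrow> 'a::ab_semigroup_add) \<Rightarrow> 'a adj0"
  assumes \<phi>: "\<phi> \<in> prefix_hom k" and c: "c \<in> center_End"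
  defines "y u \<equiv> \<lambda>_::nat. psum u (k - 1)"
  shows "map_adj0 c (\<phi> u) + map_adj0 c (\<phi> (y u)) = \<phi> (\<lambda>i. c (u i)) + map_adj0 c (\<phi> (y u))"
proof -
  have hc: "add_hom c" using c by (rule center_add_hom)
  have h\<phi>: "add_hom \<phi>" using \<phi> by (rule prefix_hom_add_hom)
  \<comment> \<open>A substitute for unit vectors: the constant sequence \<open>x\<close>, doubled
    at \<open>k\<close>. The sum of \<open>d i (u i)\<close> over \<open>i \<le> k\<close> is, at
    the coordinates up to \<open>k\<close>, the sequence \<open>u\<close> plus the constant
    \<open>psum u k\<close>.\<close>
  define d :: "nat \<Rightarrow> 'a \<Rightarrow> nat \<Rightarrow> 'a" where "d k x = (\<lambda>i. if i = k then x + x else x)" for k x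
  have d: "add_hom (d k)" for k by (auto simp: d_def add_hom_def fun_eq_iff add_ac)
  define V :: "(nat \<Rightarrow> 'a) \<Rightarrow> nat \<Rightarrow> nat \<Rightarrow> 'a" where
    "V u = rec_nat (d 0 (u 0)) (\<lambda>k r. r + d (Suc k) (u (Suc k)))" for u
  have V_simps: "V u 0 = d 0 (u 0)" "V u (Suc k) = V u k + d (Suc k) (u (Suc k))" for u k
    by (simp_all add: V_def)
  have V_eq: "V u k i = (if i \<le> k then u i + psum u k else psum u k)" for u k i
    by (induction k) (auto simp: V_simps d_def add_ac le_Suc_eq)
  have Vc: "map_adj0 c (\<phi> (V u k)) = \<phi> (V (\<lambda>i. c (u i)) k)" for k
  proof (induction k)
    case 0
    then show ?case by (simp add: V_simps prefix_hom_diag_commute[OF \<phi> c d])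
  next
    case (Suc k)
    then show ?case
      by (simp only: V_simps add_homD[OF h\<phi>] map_adj0_add[OF hc] prefix_hom_diag_commute[OF \<phi> c d])
  qed
  have Vs: "\<phi> v + \<phi> (y v) = \<phi> (V v (k - 1))" for v
  proof -
    have "\<phi> (V v (k - 1)) = \<phi> (v + y v)"
      by (rule prefix_hom_cong[OF \<phi>]) (auto simp: V_eq y_def)
    then show ?thesis by (simp add: add_homD[OF h\<phi>])
  qed
  have "map_adj0 c (\<phi> u + \<phi> (y u)) = \<phi> (\<lambda>i. c (u i)) + \<phi> (y (\<lambda>i. c (u i)))"
    unfolding Vs by (rule Vc)
  moreover have "psum (\<lambda>i. c (u i)) k = c (psum u k)" for k
    by (induction k) (simp_all add: add_homD[OF hc])
  then have "\<phi> (y (\<lambda>i. c (u i))) = map_adj0 c (\<phi> (y u))"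
    using prefix_hom_diag_commute[OF \<phi> c, of "\<lambda>x _. x" "psum u (k - 1)"]
    by (simp add: y_def add_hom_def plus_fun_def)
  ultimately show ?thesis by (simp only: map_adj0_add[OF hc])
qed

lemma prefix_hom_eval_sum:
  assumes \<phi>: "\<phi> \<in> prefix_hom k" and H: "finite H" "H \<noteq> {}"
    and x: "\<And>j. j < k \<Longrightarrow> Elt (x j) = (\<Sum>i\<in>H. Elt (z i j))"
  shows "\<phi> x = (\<Sum>i\<in>H. \<phi> (z i))"
  using H x
proof (induction H arbitrary: x rule: finite_ne_induct)
  case (singleton i)
  then have "\<phi> x = \<phi> (z i)" by (intro prefix_hom_cong[OF \<phi>]) simp
  then show ?case by simp
next
  case (insert i H)
  define x' where "x' j = elt (\<Sum>i\<in>H. Elt (z i j))" for j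
  have x': "Elt (x' j) = (\<Sum>i\<in>H. Elt (z i j))" for j
    using insert.hyps by (auto simp: x'_def adj0_sum_eq_0)
  have "Elt (x j) = Elt (z i j + x' j)" if "j < k" for j
    using insert.prems[OF that] insert.hyps by (simp add: x' Elt_add)
  then have "\<phi> x = \<phi> (z i + x')"
    by (intro prefix_hom_cong[OF \<phi>]) simp
  also have "\<dots> = \<phi> (z i) + \<phi> x'" using prefix_hom_add_hom[OF \<phi>] by (rule add_homD)
  also have "\<phi> x' = (\<Sum>i\<in>H. \<phi> (z i))" by (rule insert.IH) (rule x')
  finally show ?case using insert.hyps by simp
qed

section \<open>Deuber's theorem\<close>

definition subst_dep :: "nat \<Rightarrow> nat \<Rightarrow> ((nat \<Rightarrow> 'a::plus) \<Rightarrow> nat \<Rightarrow> 'a) \<Rightarrow> bool" where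
  "subst_dep M m \<sigma> \<longleftrightarrow> add_hom \<sigma> \<and> (\<forall>u v. (\<forall>i<M. u i = v i) \<longrightarrow> (\<forall>j<m. \<sigma> u j = \<sigma> v j))"

lemma subst_dep_prefix_hom:
  "subst_dep M m \<sigma> \<Longrightarrow> \<phi> \<in> prefix_hom m \<Longrightarrow> (\<lambda>u. \<phi> (\<sigma> u)) \<in> prefix_hom M"
  by (rule prefix_hom_subst) (auto simp: subst_dep_def)

lemma prefix_hom_mono: "k \<le> l \<Longrightarrow> prefix_hom k \<subseteq> prefix_hom l"
  unfolding prefix_hom_def using order_less_le_trans by blast

text \<open>Each \<open>a i\<close> meets its own \<open>T i\<close> inside the sum over
  \<open>J\<close>, where it can be exchanged for \<open>b i\<close> without cancellation.\<close>

lemma sum_absorb: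
  fixes a b T :: "'i \<Rightarrow> 'a::comm_monoid_add"
  assumes "finite J" "I \<subseteq> J" "\<And>i. i \<in> I \<Longrightarrow> a i + T i = b i + T i"
  shows "(\<Sum>i\<in>I. a i) + (\<Sum>i\<in>J. T i) = (\<Sum>i\<in>I. b i) + (\<Sum>i\<in>J. T i)"
proof -
  have "(\<Sum>i\<in>J. T i) = (\<Sum>i\<in>I. T i) + (\<Sum>i\<in>J - I. T i)"
    using assms(1,2) by (metis add.commute sum.subset_diff)
  moreover have "(\<Sum>i\<in>I. a i) + (\<Sum>i\<in>I. T i) = (\<Sum>i\<in>I. b i) + (\<Sum>i\<in>I. T i)"
    using assms(3) by (simp add: sum.distrib[symmetric])
  ultimately show ?thesis by (metis add.assoc)
qed

text \<open>Hales-Jewett with the homomorphisms in \<open>W\<close> as letters. A variable word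
  \<open>v\<close> becomes a substitution: its variable positions feed the lower unknowns, its
  constant positions go into the top unknown. The term of \<open>w\<close> then depends on
  \<open>v\<close> and \<open>w\<close> only through the word \<open>subst_word w v\<close>, so a
  monochromatic line of words yields equally coloured terms.\<close>

lemma top_line:
  fixes W :: "((nat \<Rightarrow> 'a::ab_semigroup_add) \<Rightarrow> 'a adj0) set"
  assumes c: "c \<in> center_End" and c1: "c1 \<in> center_End"
    and W: "finite W" "W \<subseteq> prefix_hom m"
  shows "\<exists>M S. finite S \<and> (\<forall>\<sigma>\<in>S. subst_dep M (Suc m) \<sigma> \<and>
      (\<forall>\<pi>\<in>points m c1. (\<lambda>u. \<pi> (\<sigma> u)) \<in> points M (c \<circ> c1)) \<and>
      (\<forall>w\<in>W. (\<lambda>u. w (\<sigma> u) + Elt (c (\<sigma> u m))) \<in> points M (c \<circ> c1))) \<and>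
    (\<forall>u \<chi>. (\<forall>x. \<chi> x < r) \<longrightarrow> (\<exists>\<sigma>\<in>S. \<exists>k::nat. \<forall>w\<in>W. \<chi> (w (\<sigma> u) + Elt (c (\<sigma> u m))) = k))"
proof -
  have hc: "add_hom c" and hc1: "add_hom c1" using c c1 center_add_hom by blast+
  obtain N where N: "hales_jewett W r N" using hales_jewett_exists[OF W(1)] by blast
  have idx: "j * N + i < k * N" if "j < k" "i < N" for i j k :: nat
  proof -
    have "j * N + i < Suc j * N" using that(2) by simp
    also have "\<dots> \<le> k * N" using that(1) by (intro mult_le_mono) auto
    finally show ?thesis .
  qed
  \<comment> \<open>The unknown \<open>j\<close> is replaced by the \<open>N\<close> unknowns
    \<open>j * N + i\<close>, one for each position \<open>i\<close> in a word;
    \<open>blk u i\<close> collects those of position \<open>i\<close>. The unknown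
    \<open>m * N\<close> is the new top one.\<close>
  define blk :: "(nat \<Rightarrow> 'a) \<Rightarrow> nat \<Rightarrow> nat \<Rightarrow> 'a" where "blk u i = (\<lambda>j. u (j * N + i))" for u i
  define s where "s u i = psum (blk u i) (m - 1)" for u i
  define H where "H v = {i. i < N \<and> v ! i = None}" for v :: "((nat \<Rightarrow> 'a) \<Rightarrow> 'a adj0) option list"
  define I where "I v = {i. i < N \<and> v ! i \<noteq> None}" for v :: "((nat \<Rightarrow> 'a) \<Rightarrow> 'a adj0) option list"
  define Q where "Q v u = (\<Sum>i\<in>I v. the (v ! i) (blk u i)) + (\<Sum>i<N. \<Sum>w\<in>W. w (\<lambda>_. s u i))" for v u
  \<comment> \<open>The double sum in \<open>Q\<close> runs over all letters, so that it does not depend on \<open>v\<close> and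
    absorbs the error term of \<open>prefix_hom_center_commute\<close> for every word.\<close>
  define R where "R v u j = (if j < m then \<Sum>i\<in>H v. Elt (c (u (j * N + i)))
      else Q v u + Elt (c1 (u (m * N))))" for v u j
  define \<sigma> where "\<sigma> v u j = elt (R v u j)" for v u j
  \<comment> \<open>The contribution of a full word \<open>\<omega>\<close>: its letter at position
    \<open>i\<close> acts on \<open>c\<close> of block \<open>i\<close>.\<close>
  define P where "P \<omega> u = (\<Sum>i<N. (\<omega> ! i) (\<lambda>j. c (blk u i j))) + (\<Sum>i<N. \<Sum>w\<in>W. w (\<lambda>_. c (s u i)))"
    for \<omega> u
  \<comment> \<open>How many leading unknowns suffice to determine entry \<open>j\<close> of the
    substituted sequence.\<close>
  define k1 where "k1 j = (if j < m then Suc j * N else Suc (m * N))" for j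

  have blk_hom: "(\<lambda>u. \<phi> (\<lambda>j. g (blk u i j))) \<in> prefix_hom (m * N)"
    if "\<phi> \<in> prefix_hom m" "i < N" "add_hom g" for \<phi> i and g :: "'a \<Rightarrow> 'a"
    using that by (intro prefix_hom_subst[OF that(1)])
      (auto simp: add_hom_def blk_def plus_fun_def idx)
  have s_cong: "s u i = s u' i" if "\<forall>l<m * N. u l = u' l" "i < N" "m > 0" for u u' i
    unfolding s_def using that by (intro psum_cong) (auto simp: blk_def idx)
  have s_add: "s (u + u') i = s u i + s u' i" for u u' i
    by (simp add: s_def blk_def psum_add[symmetric] plus_fun_def)
  have s_hom: "(\<lambda>u. \<phi> (\<lambda>_. g (s u i))) \<in> prefix_hom (m * N)"
    if "\<phi> \<in> prefix_hom m" "i < N" "add_hom g" for \<phi> i and g :: "'a \<Rightarrow> 'a"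
    using that
    by (intro prefix_hom_subst[OF that(1)])
      (auto simp: add_hom_def s_add fun_eq_iff intro!: arg_cong[where f = g] s_cong)
  have letter: "the (v ! i) \<in> W" if "v \<in> var_words W N" "i \<in> I v" for v i
  proof -
    have "v ! i \<in> set v" using that by (auto simp: var_words_def I_def)
    then have "v ! i \<in> insert None (Some ` W)" using that(1) unfolding var_words_def by blast
    then show ?thesis using that(2) by (auto simp: I_def)
  qed
  have Q_hom: "Q v \<in> prefix_hom (m * N)" if "v \<in> var_words W N" for v
    unfolding Q_def
    using W letter[OF that] blk_hom[where g = "\<lambda>x. x"] s_hom[where g = "\<lambda>x. x"]
    by (intro prefix_hom_add prefix_hom_sum) (auto simp: I_def add_hom_def subset_iff)
  have P_hom: "P \<omega> \<in> prefix_hom (m * N)" if "\<omega> \<in> words W N" for \<omega>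
    unfolding P_def using W that hc
    by (intro prefix_hom_add prefix_hom_sum blk_hom s_hom) (auto simp: words_def subset_iff)
  have R_hom: "(\<lambda>u. R v u j) \<in> prefix_hom (k1 j)" if "v \<in> var_words W N" for v j
  proof (cases "j < m")
    case True
    then show ?thesis
      by (auto simp: R_def k1_def H_def intro!: prefix_hom_sum prefix_hom_coord hc)
  next
    case False
    have "Q v \<in> prefix_hom (Suc (m * N))"
      using Q_hom[OF that] prefix_hom_mono[of "m * N" "Suc (m * N)"] by auto
    then show ?thesis using False
      by (auto simp: R_def k1_def intro!: prefix_hom_add prefix_hom_coord hc1)
  qed
  have H: "finite (H v)" "H v \<noteq> {}" if "v \<in> var_words W N" for v
    using that by (auto simp: H_def var_words_def in_set_conv_nth)
  have Elt_\<sigma>: "Elt (\<sigma> v u j) = R v u j" if "v \<in> var_words W N" for v u j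
  proof -
    have "R v u j \<noteq> 0" using H[OF that] by (auto simp: R_def adj0_sum_eq_0)
    then show ?thesis by (simp add: \<sigma>_def)
  qed
  have \<sigma>_hom: "add_hom (\<sigma> v)" if "v \<in> var_words W N" for v
  proof -
    have "Elt (\<sigma> v (u + u') j) = Elt (\<sigma> v u j + \<sigma> v u' j)" for u u' j
      unfolding Elt_add Elt_\<sigma>[OF that]
      using prefix_hom_add_hom[OF R_hom[OF that]] by (simp add: add_hom_def)
    then show ?thesis by (simp add: add_hom_def fun_eq_iff)
  qed
  have \<sigma>_dep: "\<sigma> v u j = \<sigma> v u' j"
    if "v \<in> var_words W N" "\<forall>i<k. u i = u' i" "k1 j \<le> k" for v u u' j k
    unfolding \<sigma>_def using that prefix_hom_cong[OF R_hom[OF that(1)]]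
    by (metis order_less_le_trans)

  \<comment> \<open>Additivity of \<open>w\<close> yields the positions in \<open>H v\<close>.
    Applying \<open>c\<close> to the top entry yields those in \<open>I v\<close>, once
    \<open>c\<close> has been moved inside the letters with the help of the absorbing double
    sum.\<close>
  have top: "w (\<sigma> v u) + Elt (c (\<sigma> v u m)) = P (subst_word w v) u + Elt ((c \<circ> c1) (u (m * N)))"
    if v: "v \<in> var_words W N" and w: "w \<in> W" for v w u
  proof -
    have "Elt (\<sigma> v u j) = (\<Sum>i\<in>H v. Elt (c (blk u i j)))" if "j < m" for j
      using that by (simp add: Elt_\<sigma>[OF v] R_def blk_def)
    moreover have w': "w \<in> prefix_hom m" using w W(2) by blast
    ultimately have "w (\<sigma> v u) = (\<Sum>i\<in>H v. w (\<lambda>j. c (blk u i j)))"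
      by (intro prefix_hom_eval_sum[OF w' H[OF v]])
    moreover have "Elt (c (\<sigma> v u m)) = map_adj0 c (Elt (\<sigma> v u m))" by simp
    then have "Elt (c (\<sigma> v u m)) = (\<Sum>i\<in>I v. map_adj0 c (the (v ! i) (blk u i))) +
        (\<Sum>i<N. \<Sum>w\<in>W. map_adj0 c (w (\<lambda>_. s u i))) + Elt ((c \<circ> c1) (u (m * N)))"
      by (simp add: Elt_\<sigma>[OF v] R_def Q_def map_adj0_add[OF hc] map_adj0_sum[OF hc])
    moreover have "(\<Sum>i\<in>I v. map_adj0 c (the (v ! i) (blk u i))) +
          (\<Sum>i<N. \<Sum>w\<in>W. map_adj0 c (w (\<lambda>_. s u i))) =
        (\<Sum>i\<in>I v. the (v ! i) (\<lambda>j. c (blk u i j))) +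
          (\<Sum>i<N. \<Sum>w\<in>W. map_adj0 c (w (\<lambda>_. s u i)))"
    proof (rule sum_absorb)
      fix i assume i: "i \<in> I v"
      then have "the (v ! i) \<in> W" by (rule letter[OF v])
      then show "map_adj0 c (the (v ! i) (blk u i)) + (\<Sum>w\<in>W. map_adj0 c (w (\<lambda>_. s u i))) =
          the (v ! i) (\<lambda>j. c (blk u i j)) + (\<Sum>w\<in>W. map_adj0 c (w (\<lambda>_. s u i)))"
        using prefix_hom_center_commute[OF _ c, of "the (v ! i)" m "blk u i"] W
        by (simp add: s_def sum.remove[of W "the (v ! i)"] subset_iff add.assoc[symmetric])
    qed (auto simp: I_def)
    moreover have "(\<Sum>i<N. \<Sum>w\<in>W. map_adj0 c (w (\<lambda>_. s u i))) = (\<Sum>i<N. \<Sum>w\<in>W. w (\<lambda>_. c (s u i)))"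
      using W(2) prefix_hom_diag_commute[OF _ c, where \<psi> = "\<lambda>x _. x" and k = m]
      by (intro sum.cong refl) (auto simp: add_hom_def plus_fun_def)
    moreover have "(\<Sum>i<N. (subst_word w v ! i) (\<lambda>j. c (blk u i j))) =
        (\<Sum>i\<in>H v. w (\<lambda>j. c (blk u i j))) + (\<Sum>i\<in>I v. the (v ! i) (\<lambda>j. c (blk u i j)))"
    proof -
      have "{..<N} = H v \<union> I v" "H v \<inter> I v = {}" "finite (H v)" "finite (I v)"
        by (auto simp: H_def I_def)
      moreover have "length v = N" using v by (simp add: var_words_def)
      then have "subst_word w v ! i = w" if "i \<in> H v" for i
        using that by (auto simp: H_def subst_word_def)
      moreover have "subst_word w v ! i = the (v ! i)" if "i \<in> I v" for i
        using that \<open>length v = N\<close> by (auto simp: I_def subst_word_def)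
      ultimately show ?thesis by (simp add: sum.union_disjoint)
    qed
    ultimately show ?thesis by (simp add: P_def add_ac)
  qed

  define M where "M = Suc (m * N)"
  have k1_le: "k1 j \<le> M" if "j < Suc m" for j
  proof (cases "j < m")
    case True
    then have "Suc j * N \<le> m * N" by (intro mult_le_mono) auto
    then show ?thesis by (simp add: k1_def M_def)
  qed (simp add: k1_def M_def)
  have low: "(\<lambda>u. \<pi> (\<sigma> v u)) \<in> points M (c \<circ> c1)"
    if v: "v \<in> var_words W N" and "\<pi> \<in> points m c1" for v \<pi>
    using that(2)
  proof (rule pointsE)
    fix j \<phi> assume j: "j < m" and \<phi>: "\<phi> \<in> prefix_hom j" and \<pi>: "\<pi> = (\<lambda>u. \<phi> u + Elt (c1 (u j)))"
    \<comment> \<open>The unknown \<open>j * N + i\<close> is the last one in entry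
      \<open>j\<close>. Its term becomes the leading term of the point; all other terms join the
      homomorphism of the preceding unknowns.\<close>
    define i where "i = Max (H v)"
    have i: "i \<in> H v" "\<And>i'. i' \<in> H v \<Longrightarrow> i' \<le> i" using H[OF v] by (auto simp: i_def)
    have "\<pi> (\<sigma> v u) = (\<phi> (\<sigma> v u) + (\<Sum>i'\<in>H v - {i}. Elt (c1 (c (u (j * N + i')))))) +
        Elt ((c \<circ> c1) (u (j * N + i)))" for u
    proof -
      have "Elt (c1 (\<sigma> v u j)) = map_adj0 c1 (Elt (\<sigma> v u j))" by simp
      also have "\<dots> = (\<Sum>i\<in>H v. Elt (c1 (c (u (j * N + i)))))"
        using j by (simp add: Elt_\<sigma>[OF v] R_def map_adj0_sum[OF hc1])
      also have "\<dots> = Elt ((c \<circ> c1) (u (j * N + i))) + (\<Sum>i'\<in>H v - {i}. Elt (c1 (c (u (j * N + i')))))"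
        using H[OF v] i center_commute[OF c hc1] by (simp add: sum.remove)
      finally show ?thesis by (simp add: \<pi> add_ac)
    qed
    moreover have "(\<lambda>u. \<phi> (\<sigma> v u)) \<in> prefix_hom (j * N + i)"
    proof (rule prefix_hom_subst[OF \<phi> \<sigma>_hom[OF v]])
      fix u u' :: "nat \<Rightarrow> 'a" and j'
      assume u: "\<forall>l<j * N + i. u l = u' l" and j': "j' < j"
      have "Suc j' * N \<le> j * N" using j' by (intro mult_le_mono) auto
      then have "k1 j' \<le> j * N + i" using j j' by (simp add: k1_def)
      then show "\<sigma> v u j' = \<sigma> v u' j'" by (rule \<sigma>_dep[OF v u])
    qed
    moreover have "(\<lambda>u. Elt (c1 (c (u (j * N + i'))))) \<in> prefix_hom (j * N + i)" if "i' \<in> H v - {i}" for i'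
    proof -
      have "i' < i" using i(2)[of i'] that by auto
      then show ?thesis
        using prefix_hom_coord[of "j * N + i'" "j * N + i" "c1 \<circ> c"] center_add_hom[OF center_comp[OF c1 c]]
        by simp
    qed
    moreover have "j * N + i < M" using idx[OF j, of i] i(1) by (simp add: M_def H_def)
    ultimately show ?thesis
      by (simp only:) (intro pointsI prefix_hom_add prefix_hom_sum)
  qed
  let ?S = "\<sigma> ` var_words W N"
  have "finite ?S" using finite_var_words[OF W(1)] by blast
  moreover have "subst_dep M (Suc m) (\<sigma> v)" if "v \<in> var_words W N" for v
    using \<sigma>_hom[OF that] \<sigma>_dep[OF that] k1_le unfolding subst_dep_def by blast
  moreover have "(\<lambda>u. w (\<sigma> v u) + Elt (c (\<sigma> v u m))) \<in> points M (c \<circ> c1)"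
    if "v \<in> var_words W N" "w \<in> W" for v w
    unfolding top[OF that]
    by (intro pointsI P_hom subst_word_in_words that) (simp add: M_def)
  moreover have "\<exists>v\<in>var_words W N. \<exists>k. \<forall>w\<in>W. \<chi> (w (\<sigma> v u) + Elt (c (\<sigma> v u m))) = k"
    if "\<forall>x. \<chi> x < r" for u and \<chi> :: "'a adj0 \<Rightarrow> nat"
  proof -
    have "\<exists>v\<in>var_words W N. \<exists>k. \<forall>w\<in>W. \<chi> (P (subst_word w v) u + Elt ((c \<circ> c1) (u (m * N)))) = k"
      using N[unfolded hales_jewett_def, rule_format,
          of "\<lambda>\<omega>. \<chi> (P \<omega> u + Elt ((c \<circ> c1) (u (m * N))))"] that by simp
    then show ?thesis using top by metis
  qed
  ultimately show ?thesis using low by (intro exI[of _ M] exI[of _ ?S]) blast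
qed

text \<open>Induction on the number of levels, with \<open>top_line\<close> for the last one. Each
  level becomes monochromatic in a colour of its own; \<open>S\<close> is finite and does not depend
  on \<open>u\<close> and \<open>\<chi>\<close>.\<close>

lemma lines:
  fixes \<Phi> :: "nat \<Rightarrow> ((nat \<Rightarrow> 'a::ab_semigroup_add) \<Rightarrow> 'a adj0) set"
  assumes c: "c \<in> center_End" and \<Phi>: "\<forall>j<m. finite (\<Phi> j) \<and> \<Phi> j \<subseteq> prefix_hom j"
  shows "\<exists>M c' S. c' \<in> center_End \<and> finite S \<and> (\<forall>\<sigma>\<in>S. subst_dep M m \<sigma> \<and>
      (\<forall>j<m. \<forall>\<phi>\<in>\<Phi> j. (\<lambda>u. \<phi> (\<sigma> u) + Elt (c (\<sigma> u j))) \<in> points M c')) \<and>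
    (\<forall>u \<chi>. (\<forall>x. \<chi> x < r) \<longrightarrow>
      (\<exists>\<sigma>\<in>S. \<forall>j<m. \<exists>k::nat. \<forall>\<phi>\<in>\<Phi> j. \<chi> (\<phi> (\<sigma> u) + Elt (c (\<sigma> u j))) = k))"
  using \<Phi>
proof (induction m)
  case 0
  have "subst_dep 0 0 (\<lambda>u::nat \<Rightarrow> 'a. u)" by (simp add: subst_dep_def add_hom_def)
  then show ?case using c by (intro exI[of _ 0] exI[of _ c] exI[of _ "{\<lambda>u. u}"]) simp
next
  case (Suc m)
  have "\<forall>j<m. finite (\<Phi> j) \<and> \<Phi> j \<subseteq> prefix_hom j" using Suc.prems by simp
  from Suc.IH[OF this] obtain M1 c1 S1 where c1: "c1 \<in> center_End" and S1: "finite S1"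
    and sub1: "\<forall>\<sigma>\<in>S1. subst_dep M1 m \<sigma> \<and>
      (\<forall>j<m. \<forall>\<phi>\<in>\<Phi> j. (\<lambda>u. \<phi> (\<sigma> u) + Elt (c (\<sigma> u j))) \<in> points M1 c1)"
    and mono1: "\<forall>u \<chi>. (\<forall>x. \<chi> x < r) \<longrightarrow>
      (\<exists>\<sigma>\<in>S1. \<forall>j<m. \<exists>k::nat. \<forall>\<phi>\<in>\<Phi> j. \<chi> (\<phi> (\<sigma> u) + Elt (c (\<sigma> u j))) = k)"
    by (elim exE conjE)
  have dep1: "subst_dep M1 m \<sigma>" if "\<sigma> \<in> S1" for \<sigma> using sub1 that by simp
  have pts1: "(\<lambda>u. \<phi> (\<sigma> u) + Elt (c (\<sigma> u j))) \<in> points M1 c1"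
    if "\<sigma> \<in> S1" "j < m" "\<phi> \<in> \<Phi> j" for \<sigma> j \<phi>
    using sub1 that by simp
  \<comment> \<open>The choice of \<open>\<sigma>1\<close> will depend on the sequence
    \<open>\<sigma>2 u\<close>, so the letters must anticipate every substitution in
    \<open>S1\<close>.\<close>
  define W where "W = (\<lambda>(\<phi>, \<sigma>) u. \<phi> (\<sigma> u)) ` (\<Phi> m \<times> S1)"
  have W_mem: "(\<lambda>u. \<phi> (\<sigma> u)) \<in> W" if "\<phi> \<in> \<Phi> m" "\<sigma> \<in> S1" for \<phi> \<sigma>
    using that unfolding W_def by (intro image_eqI[of _ _ "(\<phi>, \<sigma>)"]) auto
  have \<Phi>m: "finite (\<Phi> m)" "\<Phi> m \<subseteq> prefix_hom m" using Suc.prems by auto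
  have W_fin: "finite W" using \<Phi>m(1) S1 by (simp add: W_def)
  have W_sub: "W \<subseteq> prefix_hom M1"
    using \<Phi>m(2) subst_dep_prefix_hom[OF dep1] by (auto simp: W_def)
  obtain M S2 where S2: "finite S2"
    and sub2: "\<forall>\<sigma>\<in>S2. subst_dep M (Suc M1) \<sigma> \<and>
      (\<forall>\<pi>\<in>points M1 c1. (\<lambda>u. \<pi> (\<sigma> u)) \<in> points M (c \<circ> c1)) \<and>
      (\<forall>w\<in>W. (\<lambda>u. w (\<sigma> u) + Elt (c (\<sigma> u M1))) \<in> points M (c \<circ> c1))"
    and mono2: "\<forall>u \<chi>. (\<forall>x. \<chi> x < r) \<longrightarrow>
      (\<exists>\<sigma>\<in>S2. \<exists>k::nat. \<forall>w\<in>W. \<chi> (w (\<sigma> u) + Elt (c (\<sigma> u M1))) = k)"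
    using top_line[OF c c1 W_fin W_sub, of r] by (elim exE conjE)
  define d where "d = c \<circ> c1"
  have d: "d \<in> center_End" unfolding d_def by (rule center_comp[OF c c1])
  note sub2 = sub2[folded d_def]
  have dep2: "subst_dep M (Suc M1) \<sigma>" if "\<sigma> \<in> S2" for \<sigma> using sub2 that by simp
  have low: "(\<lambda>u. \<pi> (\<sigma> u)) \<in> points M d" if "\<sigma> \<in> S2" "\<pi> \<in> points M1 c1" for \<sigma> \<pi>
    using sub2 that by simp
  have top: "(\<lambda>u. w (\<sigma> u) + Elt (c (\<sigma> u M1))) \<in> points M d" if "\<sigma> \<in> S2" "w \<in> W" for \<sigma> w
    using sub2 that by simp
  define \<tau> where "\<tau> \<sigma>1 \<sigma>2 u j = (if j < m then \<sigma>1 (\<sigma>2 u) j else \<sigma>2 u M1)"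
    for \<sigma>1 \<sigma>2 :: "(nat \<Rightarrow> 'a) \<Rightarrow> nat \<Rightarrow> 'a" and u j
  define S where "S = (\<lambda>(\<sigma>1, \<sigma>2). \<tau> \<sigma>1 \<sigma>2) ` (S1 \<times> S2)"
  have S_mem: "\<tau> \<sigma>1 \<sigma>2 \<in> S" if "\<sigma>1 \<in> S1" "\<sigma>2 \<in> S2" for \<sigma>1 \<sigma>2
    using that unfolding S_def by (intro image_eqI[of _ _ "(\<sigma>1, \<sigma>2)"]) auto
  have eval: "\<phi> (\<tau> \<sigma>1 \<sigma>2 u) + Elt (c (\<tau> \<sigma>1 \<sigma>2 u j)) =
      \<phi> (\<sigma>1 (\<sigma>2 u)) + Elt (c (if j = m then \<sigma>2 u M1 else \<sigma>1 (\<sigma>2 u) j))"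
    if "\<phi> \<in> \<Phi> j" "j < Suc m" for \<phi> j \<sigma>1 \<sigma>2 u
  proof -
    have "\<phi> (\<tau> \<sigma>1 \<sigma>2 u) = \<phi> (\<sigma>1 (\<sigma>2 u))"
      using Suc.prems that by (intro prefix_hom_cong[of _ j]) (auto simp: \<tau>_def)
    then show ?thesis using that(2) by (simp add: \<tau>_def)
  qed
  have "finite S" using S1 S2 by (simp add: S_def)
  moreover have "subst_dep M (Suc m) (\<tau> \<sigma>1 \<sigma>2) \<and>
      (\<forall>j<Suc m. \<forall>\<phi>\<in>\<Phi> j. (\<lambda>u. \<phi> (\<tau> \<sigma>1 \<sigma>2 u) + Elt (c (\<tau> \<sigma>1 \<sigma>2 u j))) \<in> points M d)"
    if \<sigma>: "\<sigma>1 \<in> S1" "\<sigma>2 \<in> S2" for \<sigma>1 \<sigma>2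
  proof (intro conjI allI impI ballI)
    have "\<sigma>2 (u + v) = \<sigma>2 u + \<sigma>2 v" "\<sigma>1 (u + v) = \<sigma>1 u + \<sigma>1 v" for u v
      using dep1[OF \<sigma>(1)] dep2[OF \<sigma>(2)] by (simp_all add: subst_dep_def add_hom_def)
    then have "\<tau> \<sigma>1 \<sigma>2 (u + v) = \<tau> \<sigma>1 \<sigma>2 u + \<tau> \<sigma>1 \<sigma>2 v" for u v
      by (intro ext) (simp add: \<tau>_def)
    then have "add_hom (\<tau> \<sigma>1 \<sigma>2)" by (simp add: add_hom_def)
    then show "subst_dep M (Suc m) (\<tau> \<sigma>1 \<sigma>2)"
      using dep1[OF \<sigma>(1)] dep2[OF \<sigma>(2)] by (auto simp: subst_dep_def \<tau>_def)
    fix j \<phi> assume j: "j < Suc m" and \<phi>: "\<phi> \<in> \<Phi> j"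
    show "(\<lambda>u. \<phi> (\<tau> \<sigma>1 \<sigma>2 u) + Elt (c (\<tau> \<sigma>1 \<sigma>2 u j))) \<in> points M d"
    proof (cases "j = m")
      case True
      then show ?thesis
        using top[OF \<sigma>(2) W_mem[OF _ \<sigma>(1)]] \<phi> unfolding eval[OF \<phi> j] by simp
    next
      case False
      then have "j < m" using j by simp
      then show ?thesis
        using low[OF \<sigma>(2) pts1[OF \<sigma>(1) _ \<phi>]] unfolding eval[OF \<phi> j] by simp
    qed
  qed
  moreover have "\<exists>\<sigma>\<in>S. \<forall>j<Suc m. \<exists>k. \<forall>\<phi>\<in>\<Phi> j. \<chi> (\<phi> (\<sigma> u) + Elt (c (\<sigma> u j))) = k"
    if \<chi>: "\<forall>x. \<chi> x < r" for u and \<chi> :: "'a adj0 \<Rightarrow> nat"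
  proof -
    \<comment> \<open>The top level is settled first, for all members of \<open>S1\<close> together;
      then \<open>\<sigma>1\<close> is chosen for the sequence \<open>\<sigma>2 u\<close>.\<close>
    obtain \<sigma>2 k2 where \<sigma>2: "\<sigma>2 \<in> S2" "\<forall>w\<in>W. \<chi> (w (\<sigma>2 u) + Elt (c (\<sigma>2 u M1))) = k2"
      using mono2[THEN spec, of u, THEN spec, of \<chi>, THEN mp, OF \<chi>] by blast
    obtain \<sigma>1 where \<sigma>1: "\<sigma>1 \<in> S1"
      "\<forall>j<m. \<exists>k. \<forall>\<phi>\<in>\<Phi> j. \<chi> (\<phi> (\<sigma>1 (\<sigma>2 u)) + Elt (c (\<sigma>1 (\<sigma>2 u) j))) = k"
      using mono1[THEN spec, of "\<sigma>2 u", THEN spec, of \<chi>, THEN mp, OF \<chi>] by blast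
    have "\<exists>k. \<forall>\<phi>\<in>\<Phi> j. \<chi> (\<phi> (\<tau> \<sigma>1 \<sigma>2 u) + Elt (c (\<tau> \<sigma>1 \<sigma>2 u j))) = k" if "j < Suc m" for j
    proof (cases "j = m")
      case True
      have "\<chi> (\<phi> (\<tau> \<sigma>1 \<sigma>2 u) + Elt (c (\<tau> \<sigma>1 \<sigma>2 u j))) = k2" if \<phi>: "\<phi> \<in> \<Phi> j" for \<phi>
        using bspec[OF \<sigma>2(2) W_mem[OF _ \<sigma>1(1), of \<phi>]] \<phi> True
        unfolding eval[OF \<phi> \<open>j < Suc m\<close>] by simp
      then show ?thesis by blast
    next
      case False
      then have "j < m" using that by simp
      then show ?thesis using \<sigma>1(2) by (simp add: eval[OF _ that])
    qed
    then show ?thesis using S_mem[OF \<sigma>1(1) \<sigma>2(1)] by blast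
  qed
  ultimately show ?case
    using d by (intro exI[of _ M] exI[of _ d] exI[of _ S]) (auto simp: S_def)
qed

text \<open>Deuber's argument: make each of many lines monochromatic, then select lines of one colour.\<close>

lemma monochromatic_points:
  assumes c: "c \<in> center_End" and \<P>: "finite \<P>" "\<P> \<subseteq> points m c"
  shows "\<exists>M c' S. c' \<in> center_End \<and> finite S \<and> (\<forall>\<sigma>\<in>S. \<forall>\<pi>\<in>\<P>. (\<lambda>u. \<pi> (\<sigma> u)) \<in> points M c') \<and>
    (\<forall>u \<chi>. (\<forall>x. \<chi> x < r) \<longrightarrow> (\<exists>\<sigma>\<in>S. \<exists>k::nat. \<forall>\<pi>\<in>\<P>. \<chi> (\<pi> (\<sigma> u)) = k))"
proof -
  have "\<forall>\<pi>\<in>\<P>. \<exists>k \<phi>. k < m \<and> \<phi> \<in> prefix_hom k \<and> \<pi> = (\<lambda>u. \<phi> u + Elt (c (u k)))"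
    using \<P>(2) unfolding points_def by blast
  from bchoice[OF this] obtain idx
    where "\<forall>\<pi>\<in>\<P>. \<exists>\<phi>. idx \<pi> < m \<and> \<phi> \<in> prefix_hom (idx \<pi>) \<and> \<pi> = (\<lambda>u. \<phi> u + Elt (c (u (idx \<pi>))))" ..
  from bchoice[OF this] obtain ph where ph: "\<forall>\<pi>\<in>\<P>. idx \<pi> < m \<and> ph \<pi> \<in> prefix_hom (idx \<pi>) \<and>
      \<pi> = (\<lambda>u. ph \<pi> u + Elt (c (u (idx \<pi>))))" ..
  have rep: "idx \<pi> < m" "ph \<pi> \<in> prefix_hom (idx \<pi>)" "\<pi> u = ph \<pi> u + Elt (c (u (idx \<pi>)))"
    if "\<pi> \<in> \<P>" for \<pi> u
    using ph that by (blast, blast, metis)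
  \<comment> \<open>Pigeonhole: among \<open>r * m\<close> levels with \<open>r\<close> colours,
    some \<open>m\<close> levels share a colour. The maps in \<open>E\<close> are the possible
    selections of \<open>m\<close> levels.\<close>
  define L where "L = r * m"
  define E where "E = {\<iota>. \<iota> \<in> {..<m} \<rightarrow>\<^sub>E {..<L} \<and> strict_mono_on {..<m} \<iota>}"
  have "finite E" by (rule finite_subset[of _ "{..<m} \<rightarrow>\<^sub>E {..<L}"]) (auto simp: E_def intro: finite_PiE)
  \<comment> \<open>Level \<open>j\<close> receives the homomorphism of each point that some
    selection moves to \<open>j\<close>. It depends only on unknowns before \<open>j\<close> because
    the selections are increasing.\<close>
  define \<Phi> where "\<Phi> j = (\<lambda>(\<pi>, \<iota>) u. ph \<pi> (\<lambda>i. u (\<iota> i))) ` {(\<pi>, \<iota>) \<in> \<P> \<times> E. \<iota> (idx \<pi>) = j}" for j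
  have \<Phi>_mem: "(\<lambda>u. ph \<pi> (\<lambda>i. u (\<iota> i))) \<in> \<Phi> (\<iota> (idx \<pi>))" if "\<pi> \<in> \<P>" "\<iota> \<in> E" for \<pi> \<iota>
    using that unfolding \<Phi>_def by (intro image_eqI[of _ _ "(\<pi>, \<iota>)"]) auto
  have "finite (\<Phi> j) \<and> \<Phi> j \<subseteq> prefix_hom j" for j
  proof
    show "finite (\<Phi> j)" unfolding \<Phi>_def
      by (intro finite_imageI finite_subset[OF _ finite_cartesian_product[OF \<P>(1) \<open>finite E\<close>]]) auto
    show "\<Phi> j \<subseteq> prefix_hom j"
    proof
      fix \<phi> assume "\<phi> \<in> \<Phi> j"
      then obtain \<pi> \<iota> where *: "\<pi> \<in> \<P>" "\<iota> \<in> E" "\<iota> (idx \<pi>) = j" "\<phi> = (\<lambda>u. ph \<pi> (\<lambda>i. u (\<iota> i)))"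
        by (auto simp: \<Phi>_def)
      have "\<iota> i < j" if "i < idx \<pi>" for i
        using *(2,3) that rep(1)[OF *(1)] by (auto simp: E_def strict_mono_on_def)
      then show "\<phi> \<in> prefix_hom j"
        unfolding *(4) by (intro prefix_hom_subst[OF rep(2)[OF *(1)]]) (auto simp: add_hom_def fun_eq_iff)
    qed
  qed
  then have "\<forall>j<L. finite (\<Phi> j) \<and> \<Phi> j \<subseteq> prefix_hom j" by blast
  from lines[OF c this, of r] obtain M c' S where c': "c' \<in> center_End" and S: "finite S"
    and sub: "\<forall>\<sigma>\<in>S. subst_dep M L \<sigma> \<and>
      (\<forall>j<L. \<forall>\<phi>\<in>\<Phi> j. (\<lambda>u. \<phi> (\<sigma> u) + Elt (c (\<sigma> u j))) \<in> points M c')"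
    and mono: "\<forall>u \<chi>. (\<forall>x. \<chi> x < r) \<longrightarrow>
      (\<exists>\<sigma>\<in>S. \<forall>j<L. \<exists>k::nat. \<forall>\<phi>\<in>\<Phi> j. \<chi> (\<phi> (\<sigma> u) + Elt (c (\<sigma> u j))) = k)"
    by (elim exE conjE)
  have pts: "(\<lambda>u. \<phi> (\<sigma> u) + Elt (c (\<sigma> u j))) \<in> points M c'"
    if "\<sigma> \<in> S" "j < L" "\<phi> \<in> \<Phi> j" for \<sigma> j \<phi>
    using sub that by simp
  define S' where "S' = (\<lambda>(\<sigma>, \<iota>) u i. \<sigma> u (\<iota> i)) ` (S \<times> E)"
  have S'_mem: "(\<lambda>u i. \<sigma> u (\<iota> i)) \<in> S'" if "\<sigma> \<in> S" "\<iota> \<in> E" for \<sigma> \<iota>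
    using that unfolding S'_def by (intro image_eqI[of _ _ "(\<sigma>, \<iota>)"]) auto
  have \<iota>_less: "\<iota> (idx \<pi>) < L" if "\<pi> \<in> \<P>" "\<iota> \<in> E" for \<pi> \<iota>
    using that rep(1) by (auto simp: E_def)
  have "finite S'" using S \<open>finite E\<close> by (simp add: S'_def)
  moreover have "(\<lambda>u. \<pi> (\<lambda>i. \<sigma> u (\<iota> i))) \<in> points M c'" if "\<sigma> \<in> S" "\<iota> \<in> E" "\<pi> \<in> \<P>" for \<sigma> \<iota> \<pi>
    using pts[OF that(1) \<iota>_less[OF that(3,2)] \<Phi>_mem[OF that(3,2)]] by (simp add: rep(3)[OF that(3)])
  moreover have "\<exists>\<sigma>\<in>S'. \<exists>k. \<forall>\<pi>\<in>\<P>. \<chi> (\<pi> (\<sigma> u)) = k"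
    if \<chi>: "\<forall>x. \<chi> x < r" for u and \<chi> :: "'a adj0 \<Rightarrow> nat"
  proof -
    obtain \<sigma> where \<sigma>: "\<sigma> \<in> S" "\<forall>j<L. \<exists>k. \<forall>\<phi>\<in>\<Phi> j. \<chi> (\<phi> (\<sigma> u) + Elt (c (\<sigma> u j))) = k"
      using mono[THEN spec, of u, THEN spec, of \<chi>, THEN mp, OF \<chi>] by blast
    have "\<forall>j. \<exists>k. j < L \<longrightarrow> (\<forall>\<phi>\<in>\<Phi> j. \<chi> (\<phi> (\<sigma> u) + Elt (c (\<sigma> u j))) = k)"
      using \<sigma>(2) by blast
    from choice[OF this] obtain col
      where col: "\<And>j \<phi>. j < L \<Longrightarrow> \<phi> \<in> \<Phi> j \<Longrightarrow> \<chi> (\<phi> (\<sigma> u) + Elt (c (\<sigma> u j))) = col j"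
      by blast
    \<comment> \<open>On a level with \<open>\<Phi> j\<close> empty the colour \<open>col j\<close>
      is arbitrary, so it is cut down to the range below \<open>r\<close>.\<close>
    define col' where "col' j = min (col j) (r - 1)" for j
    have "r > 0" using \<chi> by (metis gr0I less_nat_zero_code)
    then have "col' \<in> {..<L} \<rightarrow> {..<r}" by (auto simp: col'_def)
    have "\<exists>k<r. m \<le> card (col' -` {k} \<inter> {..<L})"
    proof (rule ccontr)
      assume "\<not> ?thesis"
      then have *: "card (col' -` {k} \<inter> {..<L}) < m" if "k < r" for k using that by (auto simp: not_le)
      have "{..<L} = (\<Union>k<r. col' -` {k} \<inter> {..<L})" using \<open>col' \<in> _\<close> by auto
      then have "L \<le> (\<Sum>k<r. card (col' -` {k} \<inter> {..<L}))"
        by (metis card_UN_le card_lessThan finite_lessThan)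
      also have "\<dots> < (\<Sum>k<r. m)" using * \<open>r > 0\<close> by (intro sum_strict_mono) auto
      finally show False by (simp add: L_def)
    qed
    then obtain k where k: "m \<le> card (col' -` {k} \<inter> {..<L})" by blast
    then obtain J where J: "J \<subseteq> col' -` {k} \<inter> {..<L}" "card J = m" "finite J"
      by (meson obtain_subset_with_card_n)
    define \<iota> where "\<iota> = restrict (\<lambda>i. sorted_list_of_set J ! i) {..<m}"
    have \<iota>J: "\<iota> i \<in> J" if "i < m" for i
      using that J by (simp add: \<iota>_def) (metis nth_mem sorted_list_of_set.length_sorted_key_list_of_set sorted_list_of_set.set_sorted_key_list_of_set)
    have "strict_mono_on {..<m} \<iota>"
      using strict_sorted_list_of_set[of J] J
      by (auto simp: strict_mono_on_def \<iota>_def sorted_wrt_iff_nth_less)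
    then have \<iota>: "\<iota> \<in> E" using \<iota>J J(1) by (auto simp: E_def \<iota>_def)
    have "\<chi> (\<pi> (\<lambda>i. \<sigma> u (\<iota> i))) = k" if "\<pi> \<in> \<P>" for \<pi>
    proof -
      have *: "\<chi> (\<pi> (\<lambda>i. \<sigma> u (\<iota> i))) = col (\<iota> (idx \<pi>))"
        using col[OF \<iota>_less[OF that \<iota>] \<Phi>_mem[OF that \<iota>]] by (simp add: rep(3)[OF that])
      moreover have "col' (\<iota> (idx \<pi>)) = k" using \<iota>J[OF rep(1)[OF that]] J(1) by auto
      moreover have "col (\<iota> (idx \<pi>)) < r" using * \<chi> by metis
      ultimately show ?thesis by (simp add: col'_def)
    qed
    then show ?thesis by (intro bexI[OF _ S'_mem[OF \<sigma>(1) \<iota>]] exI[of _ k] ballI)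
  qed
  ultimately show ?thesis
    using c' by (intro exI[of _ M] exI[of _ c'] exI[of _ S']) (auto simp: S'_def)
qed

text \<open>Stated with points, which are stable under substitution, instead of shapes.
  \<open>large_D_subset\<close> and \<open>shape_realizes_points\<close> translate between the
  two.\<close>

definition large :: "'a::ab_semigroup_add set \<Rightarrow> bool" where
  "large B \<longleftrightarrow> (\<forall>m c \<P>. c \<in> center_End \<longrightarrow> finite \<P> \<longrightarrow> \<P> \<subseteq> points m c \<longrightarrow>
     (\<exists>u. \<forall>\<pi>\<in>\<P>. \<pi> u \<in> Elt ` B))"

lemma largeD:
  "large B \<Longrightarrow> c \<in> center_End \<Longrightarrow> finite \<P> \<Longrightarrow> \<P> \<subseteq> points m c \<Longrightarrow> \<exists>u. \<forall>\<pi>\<in>\<P>. \<pi> u \<in> Elt ` B"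
  by (auto simp: large_def)

lemma not_largeD:
  "\<not> large B \<Longrightarrow> \<exists>m c \<P>. c \<in> center_End \<and> finite \<P> \<and> \<P> \<subseteq> points m c \<and> (\<forall>u. \<exists>\<pi>\<in>\<P>. \<pi> u \<notin> Elt ` B)"
  unfolding large_def by simp

lemma large_mono: "large B \<Longrightarrow> B \<subseteq> C \<Longrightarrow> large C"
  unfolding large_def by (meson image_mono subset_iff)

lemma points_comp:
  assumes "\<pi> \<in> points m c" "add_hom d"
  shows "(\<lambda>u. \<pi> (\<lambda>i. d (u i))) \<in> points m (c \<circ> d)"
  using assms(1)
proof (rule pointsE)
  fix k \<phi> assume *: "k < m" "\<phi> \<in> prefix_hom k" "\<pi> = (\<lambda>u. \<phi> u + Elt (c (u k)))"
  have "(\<lambda>u. \<phi> (\<lambda>i. d (u i))) \<in> prefix_hom k"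
    using assms(2) by (intro prefix_hom_subst[OF *(2)]) (auto simp: add_hom_def fun_eq_iff)
  then show ?thesis using pointsI[OF *(1), of _ "c \<circ> d"] by (simp add: *(3))
qed

text \<open>Families refuting both parts are brought to the common coefficient
  \<open>c1 \<circ> c2\<close> by applying the other central map to the unknowns. A substitution
  that makes their union monochromatic puts the first family into \<open>B1\<close> or the second
  into \<open>B2\<close>.\<close>

lemma large_Un:
  assumes "large (B1 \<union> B2)"
  shows "large B1 \<or> large B2"
proof (rule ccontr)
  assume "\<not> ?thesis"
  then have "\<not> large B1" "\<not> large B2" by simp_all
  from not_largeD[OF this(1)] obtain m1 c1 \<P>1 where 1: "c1 \<in> center_End" "finite \<P>1"
    "\<P>1 \<subseteq> points m1 c1" and no1: "\<forall>u. \<exists>\<pi>\<in>\<P>1. \<pi> u \<notin> Elt ` B1"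
    by (elim exE conjE)
  from not_largeD[OF \<open>\<not> large B2\<close>] obtain m2 c2 \<P>2 where 2: "c2 \<in> center_End" "finite \<P>2"
    "\<P>2 \<subseteq> points m2 c2" and no2: "\<forall>u. \<exists>\<pi>\<in>\<P>2. \<pi> u \<notin> Elt ` B2"
    by (elim exE conjE)
  note c = 1(1) 2(1) and \<P> = 1(2,3) 2(2,3)
  define \<P> where "\<P> = (\<lambda>\<pi> u. \<pi> (\<lambda>i. c2 (u i))) ` \<P>1 \<union> (\<lambda>\<pi> u. \<pi> (\<lambda>i. c1 (u i))) ` \<P>2"
  have "c2 \<circ> c1 = c1 \<circ> c2" using center_commute[OF c(1) center_add_hom[OF c(2)]] by (simp add: fun_eq_iff)
  then have "\<P> \<subseteq> points m1 (c1 \<circ> c2) \<union> points m2 (c1 \<circ> c2)"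
    using \<P>(2,4) points_comp[OF _ center_add_hom[OF c(2)]] points_comp[OF _ center_add_hom[OF c(1)]]
    by (fastforce simp: \<P>_def)
  then have \<P>_sub: "\<P> \<subseteq> points (max m1 m2) (c1 \<circ> c2)"
    using points_mono[of m1 "max m1 m2"] points_mono[of m2 "max m1 m2"] by fastforce
  have \<P>_fin: "finite \<P>" using \<P>(1,3) by (simp add: \<P>_def)
  have cc: "c1 \<circ> c2 \<in> center_End" using center_comp[OF c] .
  obtain M c' S where c': "c' \<in> center_End" and S: "finite S"
    and pts: "\<forall>\<sigma>\<in>S. \<forall>\<pi>\<in>\<P>. (\<lambda>u. \<pi> (\<sigma> u)) \<in> points M c'"
    and mono: "\<forall>u \<chi>. (\<forall>x. \<chi> x < 2) \<longrightarrow> (\<exists>\<sigma>\<in>S. \<exists>k::nat. \<forall>\<pi>\<in>\<P>. \<chi> (\<pi> (\<sigma> u)) = k)"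
    using monochromatic_points[OF cc \<P>_fin \<P>_sub, of 2] by (elim exE conjE)
  \<comment> \<open>The suitable \<open>\<sigma>\<close> depends on \<open>u\<close>; therefore the
    points for all \<open>\<sigma>\<close> in \<open>S\<close> are realised by one
    \<open>u\<close>.\<close>
  have "\<exists>u. \<forall>\<pi>\<in>(\<lambda>(\<sigma>, \<pi>) u. \<pi> (\<sigma> u)) ` (S \<times> \<P>). \<pi> u \<in> Elt ` (B1 \<union> B2)"
    using S \<P>_fin pts by (intro largeD[OF assms c', of _ M]) auto
  then obtain u where u: "\<And>\<sigma> \<pi>. \<sigma> \<in> S \<Longrightarrow> \<pi> \<in> \<P> \<Longrightarrow> \<pi> (\<sigma> u) \<in> Elt ` (B1 \<union> B2)" by auto
  have "\<forall>x. (if x \<in> Elt ` B1 then 0 else 1 :: nat) < 2" by simp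
  from mono[THEN spec, THEN spec, THEN mp, OF this, of u]
  obtain \<sigma> k where \<sigma>: "\<sigma> \<in> S" "\<forall>\<pi>\<in>\<P>. (if \<pi> (\<sigma> u) \<in> Elt ` B1 then 0 else 1 :: nat) = k"
    by blast
  show False
  proof (cases "k = 0")
    case True
    then have "\<pi> (\<sigma> u) \<in> Elt ` B1" if "\<pi> \<in> \<P>" for \<pi>
      using \<sigma>(2) that by (metis zero_neq_one)
    then have "\<forall>\<pi>\<in>\<P>1. \<pi> (\<lambda>i. c2 (\<sigma> u i)) \<in> Elt ` B1" by (auto simp: \<P>_def)
    then show False using no1 by blast
  next
    case False
    have "\<pi> (\<sigma> u) \<in> Elt ` B2" if "\<pi> \<in> \<P>" for \<pi>
      using u[OF \<sigma>(1) that] \<sigma>(2) that False by (auto split: if_splits)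
    then have "\<forall>\<pi>\<in>\<P>2. \<pi> (\<lambda>i. c1 (\<sigma> u i)) \<in> Elt ` B2" by (auto simp: \<P>_def)
    then show False using no2 by blast
  qed
qed

lemma not_large_empty: "\<not> large ({} :: 'a::ab_semigroup_add set)"
proof
  assume "large ({} :: 'a set)"
  moreover have "id \<in> center_End" by (simp add: center_End_def mem_End_iff add_hom_def)
  moreover have "{\<lambda>u. 0 + Elt (id (u 0))} \<subseteq> points 1 id" using pointsI[OF _ prefix_hom_0] by blast
  ultimately show False using largeD[of "{}" id "{\<lambda>u. 0 + Elt (id (u 0))}" 1] by simp
qed

section \<open>The semigroup of ultrafilters\<close>

definition ultra :: "'a set set \<Rightarrow> bool" where
  "ultra p \<longleftrightarrow> {} \<notin> p \<and> (\<forall>A\<in>p. \<forall>B. A \<subseteq> B \<longrightarrow> B \<in> p) \<and> (\<forall>A\<in>p. \<forall>B\<in>p. A \<inter> B \<in> p) \<and>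
     (\<forall>A. A \<in> p \<or> - A \<in> p)"

lemma ultra_mono: "ultra p \<Longrightarrow> A \<in> p \<Longrightarrow> A \<subseteq> B \<Longrightarrow> B \<in> p"
  unfolding ultra_def by blast

lemma ultra_Int: "ultra p \<Longrightarrow> A \<in> p \<Longrightarrow> B \<in> p \<Longrightarrow> A \<inter> B \<in> p"
  unfolding ultra_def by blast

lemma ultra_not_empty: "ultra p \<Longrightarrow> {} \<notin> p"
  unfolding ultra_def by blast

lemma ultra_Compl: "ultra p \<Longrightarrow> - A \<in> p \<longleftrightarrow> A \<notin> p"
  unfolding ultra_def by (metis Compl_disjoint)

lemma ultra_UNIV: "ultra p \<Longrightarrow> UNIV \<in> p"
  using ultra_Compl[of p "{}"] ultra_not_empty by auto

lemma ultra_nonempty: "ultra p \<Longrightarrow> A \<in> p \<Longrightarrow> \<exists>x. x \<in> A"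
  using ultra_not_empty by (metis equals0I)

lemma ultra_Int_iff: "ultra p \<Longrightarrow> A \<inter> B \<in> p \<longleftrightarrow> A \<in> p \<and> B \<in> p"
  by (meson ultra_Int ultra_mono Int_lower1 Int_lower2)

lemma ultra_Inter: "finite F \<Longrightarrow> ultra p \<Longrightarrow> F \<subseteq> p \<Longrightarrow> \<Inter>F \<in> p"
  by (induction F rule: finite_induct) (auto simp: ultra_UNIV ultra_Int)

lemma ultra_INT: "ultra p \<Longrightarrow> finite I \<Longrightarrow> (\<And>i. i \<in> I \<Longrightarrow> F i \<in> p) \<Longrightarrow> (\<Inter>i\<in>I. F i) \<in> p"
  using ultra_Inter[of "F ` I" p] by blast

lemma ultra_Un: "ultra p \<Longrightarrow> A \<union> B \<in> p \<Longrightarrow> A \<in> p \<or> B \<in> p"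
  by (metis Compl_Un ultra_Compl ultra_Int)

lemma ultra_Union: "finite F \<Longrightarrow> ultra p \<Longrightarrow> \<Union>F \<in> p \<Longrightarrow> \<exists>B\<in>F. B \<in> p"
  by (induction F rule: finite_induct) (auto dest: ultra_Un ultra_not_empty)

lemma ultra_eqI: "ultra p \<Longrightarrow> ultra q \<Longrightarrow> p \<subseteq> q \<Longrightarrow> p = q"
  by (metis subsetD subsetI subset_antisym ultra_Compl)

section \<open>Existence of ultrafilters\<close>

definition fip :: "'a set set \<Rightarrow> bool" where
  "fip F \<longleftrightarrow> (\<forall>G. finite G \<longrightarrow> G \<subseteq> F \<longrightarrow> \<Inter>G \<noteq> {})"

lemma fip_insert_Compl:
  assumes "fip F"
  shows "fip (insert A F) \<or> fip (insert (- A) F)"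
proof (rule ccontr)
  assume "\<not> ?thesis"
  then obtain G H where G: "finite G" "G \<subseteq> insert A F" "\<Inter>G = {}"
    and H: "finite H" "H \<subseteq> insert (- A) F" "\<Inter>H = {}"
    by (auto simp: fip_def)
  have "\<Inter>((G - {A}) \<union> (H - {- A})) \<subseteq> \<Inter>G \<union> \<Inter>H" by auto
  moreover have "(G - {A}) \<union> (H - {- A}) \<subseteq> F" "finite ((G - {A}) \<union> (H - {- A}))" using G H by auto
  ultimately show False using assms G(3) H(3) unfolding fip_def by (metis Un_empty_left subset_empty)
qed

text \<open>A maximal family with the finite intersection property contains each set or its
  complement; a violation of another ultrafilter axiom would produce at most three members with
  empty intersection.\<close>

lemma ultra_exists:
  assumes "fip F"
  shows "\<exists>p. ultra p \<and> F \<subseteq> p"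
proof -
  have "\<exists>M\<in>{M. F \<subseteq> M \<and> fip M}. \<forall>X\<in>{M. F \<subseteq> M \<and> fip M}. M \<subseteq> X \<longrightarrow> X = M"
  proof (rule subset_Zorn_nonempty)
    fix C assume C: "C \<noteq> {}" "subset.chain {M. F \<subseteq> M \<and> fip M} C"
    have "\<Inter>G \<noteq> {}" if G: "finite G" "G \<subseteq> \<Union>C" for G
    proof -
      obtain M where "M \<in> C" "G \<subseteq> M"
        using finite_subset_Union_chain[OF G C] by blast
      then show ?thesis using C(2) G(1) unfolding subset.chain_def fip_def by blast
    qed
    moreover have "F \<subseteq> \<Union>C" using C unfolding subset.chain_def by blast
    ultimately show "\<Union>C \<in> {M. F \<subseteq> M \<and> fip M}" by (simp add: fip_def)
  qed (use assms in blast)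
  then obtain M where M: "F \<subseteq> M" "fip M" and max: "\<And>X. M \<subseteq> X \<Longrightarrow> fip X \<Longrightarrow> X = M"
    by (smt (verit) mem_Collect_eq order.trans)
  have compl: "A \<in> M \<or> - A \<in> M" for A
    using fip_insert_Compl[OF M(2), of A] max by blast
  have no: "\<Inter>G \<noteq> {}" if "finite G" "G \<subseteq> M" for G using M(2) that unfolding fip_def by blast
  have "ultra M"
    unfolding ultra_def
  proof (intro conjI ballI allI impI)
    show "{} \<notin> M" using no[of "{{}}"] by auto
    show "A \<in> M \<or> - A \<in> M" for A by (rule compl)
    show "B \<in> M" if "A \<in> M" "A \<subseteq> B" for A B
      using no[of "{A, - B}"] compl[of B] that by auto
    show "A \<inter> B \<in> M" if "A \<in> M" "B \<in> M" for A B
      using no[of "{A, B, - (A \<inter> B)}"] compl[of "A \<inter> B"] that by auto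
  qed
  then show ?thesis using M(1) by blast
qed

text \<open>Closedness in the Stone topology, where the sets of all ultrafilters containing a given
  \<open>B\<close> form a basis.\<close>

definition closed_ultra :: "'a set set set \<Rightarrow> bool" where
  "closed_ultra X \<longleftrightarrow> (\<forall>p\<in>X. ultra p) \<and> (\<forall>p. ultra p \<longrightarrow> (\<forall>B\<in>p. \<exists>q\<in>X. B \<in> q) \<longrightarrow> p \<in> X)"

lemma closed_ultraD: "closed_ultra X \<Longrightarrow> p \<in> X \<Longrightarrow> ultra p"
  by (simp add: closed_ultra_def)

lemma closed_ultraI:
  "(\<And>p. p \<in> X \<Longrightarrow> ultra p) \<Longrightarrow> (\<And>p. ultra p \<Longrightarrow> (\<And>B. B \<in> p \<Longrightarrow> \<exists>q\<in>X. B \<in> q) \<Longrightarrow> p \<in> X) \<Longrightarrow> closed_ultra X"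
  by (simp add: closed_ultra_def)

lemma closed_ultra_mem: "closed_ultra X \<Longrightarrow> ultra p \<Longrightarrow> (\<And>B. B \<in> p \<Longrightarrow> \<exists>q\<in>X. B \<in> q) \<Longrightarrow> p \<in> X"
  by (simp add: closed_ultra_def)

text \<open>A closed set of ultrafilters is recovered from the filter \<open>\<Inter>X\<close>: a
  member \<open>B\<close> of \<open>p\<close> that lies in no element of \<open>X\<close> would put
  \<open>- B\<close> into this filter.\<close>

lemma closed_ultra_mem_Inter:
  assumes "closed_ultra X" "ultra p" "\<Inter>X \<subseteq> p"
  shows "p \<in> X"
proof (rule closed_ultra_mem[OF assms(1,2)])
  fix B assume "B \<in> p"
  show "\<exists>q\<in>X. B \<in> q"
  proof (rule ccontr)
    assume "\<not> ?thesis"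
    then have "- B \<in> \<Inter>X" using assms(1) by (auto simp: ultra_Compl closed_ultra_def)
    then show False using assms(2,3) \<open>B \<in> p\<close> ultra_Compl by blast
  qed
qed

text \<open>Compactness. The filters \<open>\<Inter>X\<close> for \<open>X\<close> in the chain form
  a chain, and an ultrafilter that contains all of them lies in every \<open>X\<close>.\<close>

lemma closed_ultra_Inter_chain:
  assumes C: "C \<noteq> {}" "\<And>X Y. X \<in> C \<Longrightarrow> Y \<in> C \<Longrightarrow> X \<subseteq> Y \<or> Y \<subseteq> X"
    and cl: "\<And>X. X \<in> C \<Longrightarrow> closed_ultra X \<and> X \<noteq> {}"
  shows "closed_ultra (\<Inter>C)" "\<Inter>C \<noteq> {}"
proof -
  show "closed_ultra (\<Inter>C)"
  proof (rule closed_ultraI)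
    show "ultra p" if "p \<in> \<Inter>C" for p using that C(1) cl closed_ultraD by blast
    show "p \<in> \<Inter>C" if "ultra p" "\<And>B. B \<in> p \<Longrightarrow> \<exists>q\<in>\<Inter>C. B \<in> q" for p
      using that(2) closed_ultra_mem[OF _ that(1)] cl by (meson Inter_iff)
  qed
  have chain: "subset.chain UNIV (Inter ` C)"
    unfolding subset_chain_def
  proof (intro conjI ballI)
    fix A B assume "A \<in> Inter ` C" "B \<in> Inter ` C"
    then obtain X Y where "X \<in> C" "Y \<in> C" "A = \<Inter>X" "B = \<Inter>Y" by blast
    then show "A \<subseteq> B \<or> B \<subseteq> A" using C(2)[of X Y] Inter_anti_mono by metis
  qed simp
  have "fip (\<Union>(Inter ` C))"
    unfolding fip_def
  proof (intro allI impI)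
    fix G :: "'a set set" assume G: "finite G" "G \<subseteq> \<Union>(Inter ` C)"
    have "Inter ` C \<noteq> {}" using C(1) by simp
    from finite_subset_Union_chain[OF G this chain]
    obtain Y where "Y \<in> Inter ` C" "G \<subseteq> Y" .
    then obtain X where X: "X \<in> C" "G \<subseteq> \<Inter>X" by blast
    then obtain q where "q \<in> X" "ultra q" using cl closed_ultraD by blast
    then have "\<Inter>G \<in> q" using ultra_Inter[OF G(1)] X(2) by blast
    then show "\<Inter>G \<noteq> {}" using ultra_not_empty \<open>ultra q\<close> by metis
  qed
  then obtain p where p: "ultra p" "\<Union>(Inter ` C) \<subseteq> p" using ultra_exists by blast
  have "p \<in> X" if "X \<in> C" for X
    using closed_ultra_mem_Inter[of X p] cl[OF that] p that by blast
  then show "\<Inter>C \<noteq> {}" by blast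
qed

text \<open>Used with \<open>Q\<close> expressing that a set is a subsemigroup, and again that it is
  a left ideal.\<close>

lemma closed_ultra_minimal:
  assumes X: "closed_ultra X" "X \<noteq> {}" "Q X"
    and Q: "\<And>C. C \<noteq> {} \<Longrightarrow> (\<And>Y. Y \<in> C \<Longrightarrow> Q Y) \<Longrightarrow> Q (\<Inter>C)"
  shows "\<exists>Y. closed_ultra Y \<and> Y \<noteq> {} \<and> Q Y \<and> Y \<subseteq> X \<and>
    (\<forall>Z. closed_ultra Z \<longrightarrow> Z \<noteq> {} \<longrightarrow> Q Z \<longrightarrow> Z \<subseteq> Y \<longrightarrow> Z = Y)"
proof -
  \<comment> \<open>Complements turn the search for a minimal set into one for a maximal set, as
    Zorn's lemma for unions requires.\<close>
  define \<A> where "\<A> = {Y. closed_ultra (- Y) \<and> - Y \<noteq> {} \<and> Q (- Y) \<and> - Y \<subseteq> X}"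
  have "\<exists>M\<in>\<A>. \<forall>Y\<in>\<A>. M \<subseteq> Y \<longrightarrow> Y = M"
  proof (rule subset_Zorn_nonempty)
    have "- X \<in> \<A>" using X by (simp add: \<A>_def)
    then show "\<A> \<noteq> {}" by blast
    fix C assume C: "C \<noteq> {}" "subset.chain \<A> C"
    have sub: "C \<subseteq> \<A>" using C(2) by (simp add: subset.chain_def)
    have "\<And>Y Z. Y \<in> uminus ` C \<Longrightarrow> Z \<in> uminus ` C \<Longrightarrow> Y \<subseteq> Z \<or> Z \<subseteq> Y"
      using C(2) unfolding subset.chain_def by auto
    moreover have "\<And>Y. Y \<in> uminus ` C \<Longrightarrow> closed_ultra Y \<and> Y \<noteq> {}"
      using sub by (auto simp: \<A>_def)
    ultimately have "closed_ultra (\<Inter>(uminus ` C))" "\<Inter>(uminus ` C) \<noteq> {}"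
      using closed_ultra_Inter_chain[of "uminus ` C"] C(1) by blast+
    moreover have "Q (\<Inter>(uminus ` C))" using C(1) sub by (intro Q) (auto simp: \<A>_def)
    moreover have "\<Inter>(uminus ` C) \<subseteq> X" using C(1) sub by (auto simp: \<A>_def)
    moreover have "- \<Union>C = \<Inter>(uminus ` C)" by auto
    ultimately show "\<Union>C \<in> \<A>" by (simp add: \<A>_def)
  qed
  then obtain M where M: "M \<in> \<A>" "\<And>Y. Y \<in> \<A> \<Longrightarrow> M \<subseteq> Y \<Longrightarrow> Y = M" by blast
  have "Z = - M" if "closed_ultra Z" "Z \<noteq> {}" "Q Z" "Z \<subseteq> - M" for Z
  proof -
    have "- Z \<in> \<A>" using that M(1) by (auto simp: \<A>_def)
    then have "- Z = M" using M(2) that(4) by blast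
    then show ?thesis by blast
  qed
  then show ?thesis using M(1) by (intro exI[of _ "- M"]) (auto simp: \<A>_def)
qed

text \<open>The extension of addition to \<open>\<beta>G\<close> for which
  \<open>p \<mapsto> uadd p q\<close> is continuous for each ultrafilter \<open>q\<close>.\<close>

definition uadd :: "'a::ab_semigroup_add set set \<Rightarrow> 'a set set \<Rightarrow> 'a set set" where
  "uadd p q = {B. {x. {y. x + y \<in> B} \<in> q} \<in> p}"

lemma ultra_uadd:
  assumes "ultra p" "ultra q"
  shows "ultra (uadd p q)"
  unfolding ultra_def
proof (intro conjI ballI allI impI)
  show "{} \<notin> uadd p q" using assms by (simp add: uadd_def ultra_not_empty)
  show "B \<in> uadd p q" if "A \<in> uadd p q" "A \<subseteq> B" for A B
    using that unfolding uadd_def mem_Collect_eq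
    by (elim ultra_mono[OF assms(1)]) (auto elim!: ultra_mono[OF assms(2)])
  show "A \<inter> B \<in> uadd p q" if "A \<in> uadd p q" "B \<in> uadd p q" for A B
    using ultra_Int[OF assms(1)] that
    by (simp add: uadd_def Collect_conj_eq ultra_Int_iff[OF assms(2)] ultra_Int_iff[OF assms(1)])
  show "A \<in> uadd p q \<or> - A \<in> uadd p q" for A
    using ultra_Compl[OF assms(1)] ultra_Compl[OF assms(2)] by (simp add: uadd_def Collect_neg_eq)
qed

lemma uadd_assoc: "uadd (uadd p q) r = uadd p (uadd q r)"
  by (simp add: uadd_def add.assoc)

text \<open>The continuous image of a compact set. A preimage of \<open>r\<close> is an ultrafilter
  that extends \<open>\<Inter>X\<close> and contains the sets in \<open>E\<close>, the preimages of
  the members of \<open>r\<close>.\<close>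

lemma closed_ultra_uadd_image:
  assumes X: "closed_ultra X" and q: "ultra q"
  shows "closed_ultra ((\<lambda>p. uadd p q) ` X)"
proof (rule closed_ultraI)
  show "ultra r" if "r \<in> (\<lambda>p. uadd p q) ` X" for r
    using that closed_ultraD[OF X] ultra_uadd[OF _ q] by blast
  fix r assume r: "ultra r" and H: "\<And>B. B \<in> r \<Longrightarrow> \<exists>s\<in>(\<lambda>p. uadd p q) ` X. B \<in> s"
  have *: "\<exists>p\<in>X. {x. {y. x + y \<in> B} \<in> q} \<in> p" if B: "B \<in> r" for B
  proof -
    obtain p where "p \<in> X" "B \<in> uadd p q" using H[OF B] by blast
    then show ?thesis unfolding uadd_def by blast
  qed
  define E where "E = (\<lambda>B. {x. {y. x + y \<in> B} \<in> q}) ` r"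
  have "fip (\<Inter>X \<union> E)"
    unfolding fip_def
  proof (intro allI impI)
    fix G assume G: "finite G" "G \<subseteq> \<Inter>X \<union> E"
    have "finite (G \<inter> E)" "G \<inter> E \<subseteq> (\<lambda>B. {x. {y. x + y \<in> B} \<in> q}) ` r"
      using G(1) by (simp_all add: E_def)
    from finite_subset_image[OF this]
    obtain R where R: "R \<subseteq> r" "finite R" "G \<inter> E = (\<lambda>B. {x. {y. x + y \<in> B} \<in> q}) ` R"
      by (elim exE conjE)
    have "\<Inter>R \<in> r" using ultra_Inter[OF R(2) r R(1)] .
    then obtain p where p: "p \<in> X" "{x. {y. x + y \<in> \<Inter>R} \<in> q} \<in> p" using * by blast
    have up: "ultra p" using X p(1) closed_ultraD by blast
    have "B \<in> p" if "B \<in> G" for B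
    proof (cases "B \<in> E")
      case True
      have "B \<in> (\<lambda>B. {x. {y. x + y \<in> B} \<in> q}) ` R" unfolding R(3)[symmetric] using True that by simp
      then obtain B' where B': "B = {x. {y. x + y \<in> B'} \<in> q}" "B' \<in> R" by (rule imageE)
      have "{y. x + y \<in> B'} \<in> q" if "{y. x + y \<in> \<Inter>R} \<in> q" for x
        using B'(2) by (intro ultra_mono[OF q that]) blast
      then have "{x. {y. x + y \<in> \<Inter>R} \<in> q} \<subseteq> B" unfolding B'(1) by blast
      then show ?thesis by (rule ultra_mono[OF up p(2)])
    next
      case False
      then show ?thesis using G(2) that p(1) by blast
    qed
    then have "\<Inter>G \<in> p" using ultra_Inter[OF G(1) up] by blast
    then show "\<Inter>G \<noteq> {}" using ultra_not_empty[OF up] by metis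
  qed
  then obtain p where p: "ultra p" "\<Inter>X \<union> E \<subseteq> p" using ultra_exists by blast
  then have "p \<in> X" using closed_ultra_mem_Inter[OF X] by blast
  moreover have "r \<subseteq> uadd p q" using p(2) by (auto simp: uadd_def E_def)
  then have "r = uadd p q" by (rule ultra_eqI[OF r ultra_uadd[OF p(1) q]])
  ultimately show "r \<in> (\<lambda>p. uadd p q) ` X" by blast
qed

lemma closed_ultra_uadd_eq:
  assumes X: "closed_ultra X" and q: "ultra q" and r: "ultra r"
  shows "closed_ultra {p\<in>X. uadd p q = r}"
proof (rule closed_ultraI)
  show "ultra p" if "p \<in> {p\<in>X. uadd p q = r}" for p using that closed_ultraD[OF X] by blast
  fix p assume p: "ultra p" and *: "\<And>B. B \<in> p \<Longrightarrow> \<exists>s\<in>{p\<in>X. uadd p q = r}. B \<in> s"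
  have "p \<in> X" using * by (intro closed_ultra_mem[OF X p]) blast
  have "B \<in> uadd p q" if "B \<in> r" for B
  proof (rule ccontr)
    assume "B \<notin> uadd p q"
    then have "- {x. {y. x + y \<in> B} \<in> q} \<in> p" using ultra_Compl[OF p] by (simp add: uadd_def)
    then obtain s where s: "s \<in> X" "uadd s q = r" "- {x. {y. x + y \<in> B} \<in> q} \<in> s" using * by blast
    then show False using that ultra_Compl[OF closed_ultraD[OF X s(1)]] by (auto simp: uadd_def)
  qed
  then have "uadd p q = r" using ultra_eqI[OF r ultra_uadd[OF p q]] by blast
  then show "p \<in> {p\<in>X. uadd p q = r}" using \<open>p \<in> X\<close> by blast
qed

text \<open>The Ellis-Numakura lemma. In a minimal closed subsemigroup \<open>Y\<close> with an
  element \<open>p\<close>, minimality gives \<open>Y + p = Y\<close>, and then that the solutions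
  \<open>q\<close> of \<open>q + p = p\<close> fill \<open>Y\<close>; one of them is
  \<open>p\<close>.\<close>

lemma uadd_idempotent_exists:
  assumes X: "closed_ultra X" "X \<noteq> {}" "\<And>p q. p \<in> X \<Longrightarrow> q \<in> X \<Longrightarrow> uadd p q \<in> X"
  shows "\<exists>p\<in>X. uadd p p = p"
proof -
  define Q where "Q = (\<lambda>Y. \<forall>p\<in>Y. \<forall>q\<in>Y. uadd p q \<in> (Y :: 'a set set set))"
  have "Q (\<Inter>C)" if "C \<noteq> {}" "\<And>Y. Y \<in> C \<Longrightarrow> Q Y" for C using that unfolding Q_def by blast
  moreover have "Q X" using X(3) by (simp add: Q_def)
  ultimately obtain Y where Y: "closed_ultra Y" "Y \<noteq> {}" "Q Y" "Y \<subseteq> X"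
    and min: "\<And>Z. closed_ultra Z \<Longrightarrow> Z \<noteq> {} \<Longrightarrow> Q Z \<Longrightarrow> Z \<subseteq> Y \<Longrightarrow> Z = Y"
    using closed_ultra_minimal[OF X(1,2), of Q] by metis
  obtain p where p: "p \<in> Y" using Y(2) by blast
  have up: "ultra p" using p Y(1) closed_ultraD by blast
  have "(\<lambda>q. uadd q p) ` Y = Y"
  proof (rule min)
    show "closed_ultra ((\<lambda>q. uadd q p) ` Y)" using Y(1) up by (rule closed_ultra_uadd_image)
    show "Q ((\<lambda>q. uadd q p) ` Y)"
      unfolding Q_def
    proof (intro ballI)
      fix a b assume "a \<in> (\<lambda>q. uadd q p) ` Y" "b \<in> (\<lambda>q. uadd q p) ` Y"
      then obtain a' b' where ab: "a' \<in> Y" "b' \<in> Y" "a = uadd a' p" "b = uadd b' p" by blast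
      then have "uadd (uadd a' p) b' \<in> Y" using p Y(3) unfolding Q_def by blast
      then show "uadd a b \<in> (\<lambda>q. uadd q p) ` Y"
        by (rule rev_image_eqI) (simp add: ab uadd_assoc)
    qed
  qed (use p Y(3) in \<open>auto simp: Q_def\<close>)
  then obtain y where "y \<in> Y" "uadd y p = p" using p by (metis imageE)
  then have "{q\<in>Y. uadd q p = p} \<noteq> {}" by blast
  moreover have "Q {q\<in>Y. uadd q p = p}" using Y(3) by (auto simp: Q_def uadd_assoc)
  ultimately have "{q\<in>Y. uadd q p = p} = Y"
    using min closed_ultra_uadd_eq[OF Y(1) up up] by blast
  then show ?thesis using p Y(4) by blast
qed

text \<open>The idempotent is taken in a minimal left ideal \<open>L\<close>. If it were the principal ultrafilter at
  some \<open>e\<close>, then \<open>e\<close> would be a left multiple of every member of \<open>L\<close>; but a non-principal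
  ultrafilter containing \<open>e + G\<close> has no inverse with respect to \<open>e\<close>, since \<open>x + y = e\<close> has at most
  one solution \<open>y\<close> in \<open>e + G\<close>.\<close>

lemma nonprincipal_idempotent_exists:
  fixes S :: "'a::ab_semigroup_add set set set"
  assumes S: "closed_ultra S" "S \<noteq> {}" "\<And>p q. p \<in> S \<Longrightarrow> q \<in> S \<Longrightarrow> uadd p q \<in> S"
    and np: "\<And>e. e + e = e \<Longrightarrow> \<exists>p\<in>S. \<forall>z. {y. e + y = z} \<notin> p"
  shows "\<exists>p\<in>S. uadd p p = p \<and> (\<forall>x. {x} \<notin> p)"
proof -
  define Q where "Q = (\<lambda>L. \<forall>p\<in>S. \<forall>q\<in>L. uadd p q \<in> (L :: 'a set set set))"
  have "Q (\<Inter>C)" if "C \<noteq> {}" "\<And>Y. Y \<in> C \<Longrightarrow> Q Y" for C using that unfolding Q_def by blast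
  moreover have "Q S" using S(3) by (simp add: Q_def)
  ultimately obtain L where L: "closed_ultra L" "L \<noteq> {}" "Q L" "L \<subseteq> S"
    and min: "\<And>Z. closed_ultra Z \<Longrightarrow> Z \<noteq> {} \<Longrightarrow> Q Z \<Longrightarrow> Z \<subseteq> L \<Longrightarrow> Z = L"
    using closed_ultra_minimal[OF S(1,2), of Q] by metis
  have QL: "uadd p q \<in> L" if "p \<in> S" "q \<in> L" for p q using L(3) that unfolding Q_def by blast
  have "\<exists>p\<in>L. uadd p p = p"
    using L(4) QL by (intro uadd_idempotent_exists[OF L(1,2)]) blast
  then obtain p where p: "p \<in> L" "uadd p p = p" by blast
  have "{e} \<notin> p" for e
  proof
    assume e: "{e} \<in> p"
    have p_iff: "B \<in> p \<longleftrightarrow> e \<in> B" for B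
      using e closed_ultraD[OF L(1) p(1)]
      by (metis Compl_iff empty_subsetI insert_subset ultra_Compl ultra_mono)
    have ee: "e + e = e"
    proof -
      have "{e} \<in> uadd p p" using e p(2) by simp
      then show ?thesis by (simp add: uadd_def p_iff)
    qed
    obtain q where q: "q \<in> S" "\<And>z. {y. e + y = z} \<notin> q" using np[OF ee] by blast
    \<comment> \<open>As \<open>p\<close> is principal at \<open>e\<close>, this is the translate of
      \<open>q\<close> by \<open>e\<close>. It lies in the left ideal \<open>L\<close>, whose
      minimality makes \<open>p\<close> a left multiple of it.\<close>
    define q' where "q' = uadd q p"
    have q': "q' \<in> L" unfolding q'_def using QL q(1) p(1) by blast
    have uq': "ultra q'" using q' L(1) closed_ultraD by blast
    have "(\<lambda>s. uadd s q') ` S = L"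
    proof (rule min)
      show "closed_ultra ((\<lambda>s. uadd s q') ` S)" by (rule closed_ultra_uadd_image[OF S(1) uq'])
      show "Q ((\<lambda>s. uadd s q') ` S)"
        unfolding Q_def
      proof (intro ballI)
        fix a b assume "a \<in> S" "b \<in> (\<lambda>s. uadd s q') ` S"
        then obtain s where s: "s \<in> S" "b = uadd s q'" by blast
        show "uadd a b \<in> (\<lambda>s. uadd s q') ` S"
          by (rule rev_image_eqI[OF S(3)[OF \<open>a \<in> S\<close> s(1)]]) (simp add: s(2) uadd_assoc)
      qed
    qed (use S(2) QL q' in auto)
    then obtain s where s: "s \<in> S" "uadd s q' = p" using p(1) by (metis imageE)
    then have "{e} \<in> uadd s q'" using e by simp
    then have "{x. {y. x + y = e} \<in> q'} \<in> s" by (simp add: uadd_def)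
    then obtain x where x: "{y. x + y = e} \<in> q'"
      using ultra_nonempty[OF closed_ultraD[OF S(1) s(1)]] by auto
    then have y: "{y. x + (y + e) = e} \<in> q" by (simp add: q'_def uadd_def p_iff)
    obtain y0 where y0: "x + (y0 + e) = e"
      using ultra_nonempty[OF closed_ultraD[OF S(1) q(1)] y] by auto
    have "e + y = e + y0" if "x + (y + e) = e" for y
    proof -
      have "e + y = (x + (y0 + e)) + y" using y0 by simp
      also have "\<dots> = (x + (y + e)) + y0" by (simp add: add_ac)
      finally show ?thesis using that by simp
    qed
    then have "{y. e + y = e + y0} \<in> q"
      by (intro ultra_mono[OF closed_ultraD[OF S(1) q(1)] y]) auto
    then show False using q(2) by blast
  qed
  then show ?thesis using p L(4) by blast
qed

section \<open>Shapes and configurations\<close>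

text \<open>Adding \<open>c (s ! Suc k)\<close> to it gives the value of the point at
  \<open>u i = s ! 0 + s ! Suc i\<close>. Its summand \<open>c (xs ! 0)\<close> comes from
  \<open>c (u k)\<close> and ensures a value in G when \<open>\<phi>\<close> is absent.\<close>

definition line_fun :: "('a \<Rightarrow> 'a) \<Rightarrow> nat \<Rightarrow> ((nat \<Rightarrow> 'a::ab_semigroup_add) \<Rightarrow> 'a adj0) \<Rightarrow> 'a list \<Rightarrow> 'a" where
  "line_fun c k \<phi> = restrict (\<lambda>xs. elt (\<phi> (\<lambda>i. xs ! 0 + xs ! Suc i) + Elt (c (xs ! 0)))) (pow_carrier (Suc k))"

lemma Elt_line_fun:
  "length xs = Suc k \<Longrightarrow> Elt (line_fun c k \<phi> xs) = \<phi> (\<lambda>i. xs ! 0 + xs ! Suc i) + Elt (c (xs ! 0))"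
  by (simp add: line_fun_def pow_carrier_def)

lemma line_fun_Hom:
  assumes "\<phi> \<in> prefix_hom k" "add_hom c"
  shows "line_fun c k \<phi> \<in> Hom (pow_carrier (Suc k)) pow_add"
proof -
  have "line_fun c k \<phi> (pow_add x y) = line_fun c k \<phi> x + line_fun c k \<phi> y"
    if len: "length x = Suc k" "length y = Suc k" for x y
  proof -
    have "\<phi> (\<lambda>i. pow_add x y ! 0 + pow_add x y ! Suc i) =
        \<phi> ((\<lambda>i. x ! 0 + x ! Suc i) + (\<lambda>i. y ! 0 + y ! Suc i))"
      using len by (intro prefix_hom_cong[OF assms(1)]) (simp add: pow_add_def add_ac)
    also have "\<dots> = \<phi> (\<lambda>i. x ! 0 + x ! Suc i) + \<phi> (\<lambda>i. y ! 0 + y ! Suc i)"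
      by (rule add_homD[OF prefix_hom_add_hom[OF assms(1)]])
    finally have "Elt (line_fun c k \<phi> (pow_add x y)) = Elt (line_fun c k \<phi> x + line_fun c k \<phi> y)"
      using len add_homD[OF assms(2)]
      by (simp add: Elt_line_fun Elt_add pow_add_def add_ac)
    then show ?thesis by simp
  qed
  then show ?thesis by (auto simp: Hom_def line_fun_def pow_carrier_def)
qed

text \<open>Passing from \<open>s\<close> to \<open>u\<^sub>i = s\<^sub>0 + s\<^sub>i\<^sub>+\<^sub>1\<close> realises all points of \<open>points m c\<close>, even those
  whose homomorphism is absent, inside sets of the form \<open>D(\<lambda>; s)\<close>.\<close>

lemma line_fun_point:
  assumes "\<phi> \<in> prefix_hom k" "add_hom c" "Suc k < length s"
  defines "u \<equiv> \<lambda>i. s ! 0 + s ! Suc i"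
  shows "\<phi> u + Elt (c (u k)) = Elt (line_fun c k \<phi> (take (Suc k) s) + c (s ! Suc k))"
proof -
  have "\<phi> (\<lambda>i. take (Suc k) s ! 0 + take (Suc k) s ! Suc i) = \<phi> u"
    by (rule prefix_hom_cong[OF assms(1)]) (simp add: u_def)
  then show ?thesis
    using assms(3) add_homD[OF assms(2)] by (simp add: Elt_line_fun Elt_add u_def add_ac)
qed

text \<open>Levels to which no point belongs get an empty set of homomorphisms. Hence the length
  \<open>M\<close> can be arbitrarily large, which supplies infinitely many shapes for the same
  points.\<close>

lemma shape_realizes_points:
  assumes c: "c \<in> center_End" and \<P>: "finite \<P>" "\<P> \<subseteq> points m c" and M: "m \<le> M" "1 \<le> M"
  shows "\<exists>F. (M, F, c) \<in> Lambda_t \<and>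
    (\<forall>s. length s = Suc M \<longrightarrow> (\<exists>u. \<forall>\<pi>\<in>\<P>. \<pi> u \<in> Elt ` D (M, F, c) s))"
proof -
  have hc: "add_hom c" using c by (rule center_add_hom)
  have "\<forall>\<pi>\<in>\<P>. \<exists>k \<phi>. k < m \<and> \<phi> \<in> prefix_hom k \<and> \<pi> = (\<lambda>u. \<phi> u + Elt (c (u k)))"
    using \<P>(2) unfolding points_def by blast
  from bchoice[OF this] obtain idx
    where "\<forall>\<pi>\<in>\<P>. \<exists>\<phi>. idx \<pi> < m \<and> \<phi> \<in> prefix_hom (idx \<pi>) \<and> \<pi> = (\<lambda>u. \<phi> u + Elt (c (u (idx \<pi>))))" ..
  from bchoice[OF this] obtain ph where ph: "\<forall>\<pi>\<in>\<P>. idx \<pi> < m \<and> ph \<pi> \<in> prefix_hom (idx \<pi>) \<and>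
      \<pi> = (\<lambda>u. ph \<pi> u + Elt (c (u (idx \<pi>))))" ..
  have rep: "idx \<pi> < m" "ph \<pi> \<in> prefix_hom (idx \<pi>)" "\<pi> u = ph \<pi> u + Elt (c (u (idx \<pi>)))"
    if "\<pi> \<in> \<P>" for \<pi> u
    using ph that by (blast, blast, metis)
  define F where "F = map (\<lambda>k. (\<lambda>\<pi>. line_fun c k (ph \<pi>)) ` {\<pi> \<in> \<P>. idx \<pi> = k}) [0..<M]"
  have F_nth: "F ! k = (\<lambda>\<pi>. line_fun c k (ph \<pi>)) ` {\<pi> \<in> \<P>. idx \<pi> = k}" if "k < M" for k
    using that by (simp add: F_def)
  have F_j: "finite (F ! (j - 1))" "F ! (j - 1) \<subseteq> Hom (pow_carrier j) pow_add" if "j \<in> {1..M}" for j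
  proof -
    have j: "j - 1 < M" "Suc (j - 1) = j" using that by auto
    show "finite (F ! (j - 1))" unfolding F_nth[OF j(1)] using \<P>(1) by simp
    have "line_fun c (j - 1) (ph \<pi>) \<in> Hom (pow_carrier j) pow_add" if "\<pi> \<in> \<P>" "idx \<pi> = j - 1" for \<pi>
      using line_fun_Hom[OF _ hc, of "ph \<pi>" "j - 1"] rep(2)[OF that(1)] unfolding that(2) j(2) by simp
    then show "F ! (j - 1) \<subseteq> Hom (pow_carrier j) pow_add" unfolding F_nth[OF j(1)] by blast
  qed
  have "(M, F, c) \<in> Lambda_t"
  proof -
    have "F ! (j - 1) \<subseteq> pow_carrier j \<rightarrow>\<^sub>E UNIV" if "j \<in> {1..M}" for j
      using F_j(2)[OF that] unfolding Hom_def by blast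
    moreover have "c \<in> End" "length F = M" using hc by (simp_all add: mem_End_iff F_def)
    ultimately show ?thesis using M(2) c F_j unfolding Lambda_t_def shapes_def by blast
  qed
  moreover have "\<exists>u. \<forall>\<pi>\<in>\<P>. \<pi> u \<in> Elt ` D (M, F, c) s" if s: "length s = Suc M" for s
  proof (intro exI ballI)
    fix \<pi> assume \<pi>: "\<pi> \<in> \<P>"
    let ?k = "idx \<pi>"
    have k: "?k < M" using rep(1)[OF \<pi>] M(1) by simp
    have "line_fun c ?k (ph \<pi>) \<in> F ! ?k" using \<pi> by (auto simp: F_nth[OF k])
    then have "line_fun c ?k (ph \<pi>) (take (Suc ?k) s) + c (s ! Suc ?k) \<in> D (M, F, c) s"
      using k by (auto simp: D_def intro!: bexI[of _ "Suc ?k"])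
    moreover have "\<pi> (\<lambda>i. s ! 0 + s ! Suc i) =
        Elt (line_fun c ?k (ph \<pi>) (take (Suc ?k) s) + c (s ! Suc ?k))"
      using line_fun_point[OF rep(2)[OF \<pi>] hc, of s] k s by (simp add: rep(3)[OF \<pi>])
    ultimately show "\<pi> (\<lambda>i. s ! 0 + s ! Suc i) \<in> Elt ` D (M, F, c) s" by blast
  qed
  ultimately show ?thesis by blast
qed

lemma finite_D:
  assumes "(m, F, c) \<in> Lambda_t"
  shows "finite (D (m, F, c) s)"
proof -
  have "{f (take j s) + c (s ! j) |f. f \<in> F ! (j - 1)} = (\<lambda>f. f (take j s) + c (s ! j)) ` (F ! (j - 1))" for j
    by auto
  then show ?thesis using assms by (auto simp: D_def Lambda_t_def shapes_def)
qed

text \<open>The elements of \<open>D\<close> are finitely many points in the unknowns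
  \<open>t\<close>; the term \<open>c (t ! 0)\<close> is the one with absent homomorphism.\<close>

lemma large_D_subset:
  assumes B: "large B" and l: "(m, F, c) \<in> Lambda_t"
  shows "\<exists>t. length t = Suc m \<and> D (m, F, c) t \<subseteq> B"
proof -
  have c: "c \<in> center_End" using l by (simp add: Lambda_t_def)
  define pt where "pt j f u = Elt (f (map u [0..<j])) + Elt (c (u j))" for j f and u :: "nat \<Rightarrow> 'a"
  define \<P> where "\<P> = insert (\<lambda>u. 0 + Elt (c (u 0))) (\<Union>j\<in>{1..m}. pt j ` (F ! (j - 1)))"
  have F: "finite (F ! (j - 1))" "F ! (j - 1) \<subseteq> Hom (pow_carrier j) pow_add" if "j \<in> {1..m}" for j
    using l that by (auto simp: Lambda_t_def shapes_def)
  have "pt j f \<in> points (Suc m) c" if "j \<in> {1..m}" "f \<in> F ! (j - 1)" for j f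
  proof -
    have "f (map (u + v) [0..<j]) = f (map u [0..<j]) + f (map v [0..<j])" for u v
    proof -
      have "map (u + v) [0..<j] = pow_add (map u [0..<j]) (map v [0..<j])"
        by (intro nth_equalityI) (simp_all add: pow_add_def)
      then show ?thesis using F(2)[OF that(1)] that(2) by (auto simp: Hom_def pow_carrier_def)
    qed
    then have "(\<lambda>u. Elt (f (map u [0..<j]))) \<in> prefix_hom j"
      by (auto simp: prefix_hom_def add_hom_def Elt_add intro!: arg_cong[where f = f])
    then show ?thesis unfolding pt_def using that(1) by (intro pointsI) auto
  qed
  then have "\<P> \<subseteq> points (Suc m) c"
    using pointsI[OF _ prefix_hom_0, of 0 "Suc m"] by (auto simp: \<P>_def)
  moreover have "finite \<P>" using F(1) by (simp add: \<P>_def)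
  ultimately obtain u where u: "\<forall>\<pi>\<in>\<P>. \<pi> u \<in> Elt ` B" using largeD[OF B c] by blast
  let ?t = "map u [0..<Suc m]"
  have nth: "?t ! j = u j" "take j ?t = map u [0..<j]" if "j \<le> m" for j
    using that by (auto simp: take_map simp del: upt_Suc)
  have "c (u 0) \<in> B" using u by (auto simp: \<P>_def)
  moreover have "f (map u [0..<j]) + c (u j) \<in> B" if "j \<in> {1..m}" "f \<in> F ! (j - 1)" for j f
  proof -
    have "pt j f u \<in> Elt ` B" using u that unfolding \<P>_def by blast
    then show ?thesis by (auto simp: pt_def Elt_add[symmetric])
  qed
  ultimately have "D (m, F, c) ?t \<subseteq> B"
    using nth by (auto simp: D_def simp del: upt_Suc)
  then show ?thesis by (intro exI[of _ ?t]) simp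
qed

section \<open>Finite sums over sets of shapes\<close>

lemma Elt_nsum: "finite I \<Longrightarrow> I \<noteq> {} \<Longrightarrow> Elt (nsum a I) = (\<Sum>i\<in>I. Elt (a i))"
  by (induction I rule: finite_ne_induct) (simp_all add: nsum_insert Elt_add)

lemma sum_sets_add:
  assumes "x \<in> sum_sets E I" "y \<in> sum_sets E J"
    and "finite I" "I \<noteq> {}" "finite J" "J \<noteq> {}" "I \<inter> J = {}"
  shows "x + y \<in> sum_sets E (I \<union> J)"
proof -
  obtain a b where a: "x = nsum a I" "\<forall>i\<in>I. a i \<in> E i" and b: "y = nsum b J" "\<forall>i\<in>J. b i \<in> E i"
    using assms(1,2) by (auto simp: sum_sets_def)
  define d where "d i = (if i \<in> I then a i else b i)" for i
  have "Elt (x + y) = (\<Sum>i\<in>I. Elt (a i)) + (\<Sum>i\<in>J. Elt (b i))"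
    using assms by (simp add: a(1) b(1) Elt_add Elt_nsum)
  also have "(\<Sum>i\<in>I. Elt (a i)) = (\<Sum>i\<in>I. Elt (d i))" by (intro sum.cong) (simp_all add: d_def)
  also have "(\<Sum>i\<in>J. Elt (b i)) = (\<Sum>i\<in>J. Elt (d i))"
    using assms(7) by (intro sum.cong) (auto simp: d_def)
  also have "(\<Sum>i\<in>I. Elt (d i)) + (\<Sum>i\<in>J. Elt (d i)) = Elt (nsum d (I \<union> J))"
    using assms by (simp add: Elt_nsum sum.union_disjoint)
  finally have "x + y = nsum d (I \<union> J)" by simp
  moreover have "\<forall>i\<in>I \<union> J. d i \<in> E i" using a(2) b(2) by (auto simp: d_def)
  ultimately show ?thesis unfolding sum_sets_def by blast
qed

text \<open>The members of a system that avoid finitely many shapes. Letting \<open>F\<close> grow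
  singles out a subsemigroup of \<open>\<beta>G\<close>.\<close>

definition tail_sums :: "('i \<Rightarrow> 'a::ab_semigroup_add set) \<Rightarrow> 'i set \<Rightarrow> 'i set \<Rightarrow> 'a set" where
  "tail_sums E L F = (\<Union>I\<in>{I. finite I \<and> I \<noteq> {} \<and> I \<subseteq> L - F}. sum_sets E I)"

lemma tail_sums_antimono: "F \<subseteq> F' \<Longrightarrow> tail_sums E L F' \<subseteq> tail_sums E L F"
  unfolding tail_sums_def by blast

lemma subset_tail_sums: "l \<in> L - F \<Longrightarrow> E l \<subseteq> tail_sums E L F"
proof
  fix x assume l: "l \<in> L - F" and x: "x \<in> E l"
  have "x = nsum (\<lambda>_. x) {l}" by simp
  then have "x \<in> sum_sets E {l}" unfolding sum_sets_def using x by blast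
  then show "x \<in> tail_sums E L F" unfolding tail_sums_def using l by (intro UN_I[of "{l}"]) auto
qed

text \<open>\<open>F'\<close> is the set of shapes used for \<open>x\<close>; sums over other shapes
  can be added without using a shape twice.\<close>

lemma tail_sums_add:
  assumes "x \<in> tail_sums E L F"
  shows "\<exists>F'. finite F' \<and> (\<forall>y\<in>tail_sums E L (F \<union> F'). x + y \<in> tail_sums E L F)"
proof -
  obtain I where I: "finite I" "I \<noteq> {}" "I \<subseteq> L - F" "x \<in> sum_sets E I"
    using assms by (auto simp: tail_sums_def)
  have "x + y \<in> tail_sums E L F" if y: "y \<in> tail_sums E L (F \<union> I)" for y
  proof -
    obtain J where J: "finite J" "J \<noteq> {}" "J \<subseteq> L - (F \<union> I)" "y \<in> sum_sets E J"
      using y by (auto simp: tail_sums_def)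
    then have "x + y \<in> sum_sets E (I \<union> J)" using I by (intro sum_sets_add) auto
    then show ?thesis
      unfolding tail_sums_def using I J by (intro UN_I[of "I \<union> J"]) auto
  qed
  then show ?thesis using I(1) by blast
qed

section \<open>Systems and idempotent ultrafilters\<close>

text \<open>Infinitely many shapes realise the points in question, and their sets \<open>D\<close> are disjoint, so
  that one of them avoids the finite set \<open>Z\<close>.\<close>

lemma system_realizes_points:
  assumes s: "\<forall>l\<in>Lambda_t. s l \<in> pow_carrier (fst l + 1)"
    and disj: "\<forall>l1\<in>Lambda_t. \<forall>l2\<in>Lambda_t. l1 \<noteq> l2 \<longrightarrow> D l1 (s l1) \<inter> D l2 (s l2) = {}"
    and c: "c \<in> center_End" and \<P>: "finite \<P>" "\<P> \<subseteq> points m c"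
    and fin: "finite F" "finite Z"
  shows "\<exists>l\<in>Lambda_t - F. D l (s l) \<inter> Z = {} \<and> (\<exists>u. \<forall>\<pi>\<in>\<P>. \<pi> u \<in> Elt ` D l (s l))"
proof -
  define N where "N = {max m 1..}"
  have "\<forall>M\<in>N. \<exists>Fs. (M, Fs, c) \<in> Lambda_t \<and>
      (\<forall>s. length s = Suc M \<longrightarrow> (\<exists>u. \<forall>\<pi>\<in>\<P>. \<pi> u \<in> Elt ` D (M, Fs, c) s))"
    using shape_realizes_points[OF c \<P>] by (simp add: N_def)
  from bchoice[OF this] obtain Fs where Fs: "\<forall>M\<in>N. (M, Fs M, c) \<in> Lambda_t \<and>
      (\<forall>s. length s = Suc M \<longrightarrow> (\<exists>u. \<forall>\<pi>\<in>\<P>. \<pi> u \<in> Elt ` D (M, Fs M, c) s))" ..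
  define l where "l M = (M, Fs M, c)" for M
  have l: "l M \<in> Lambda_t" "\<exists>u. \<forall>\<pi>\<in>\<P>. \<pi> u \<in> Elt ` D (l M) (s (l M))" if "M \<in> N" for M
  proof -
    show mem: "l M \<in> Lambda_t" using Fs that by (simp add: l_def)
    have "s (l M) \<in> pow_carrier (fst (l M) + 1)" using s mem by blast
    then have "length (s (l M)) = Suc M" by (simp add: pow_carrier_def l_def)
    then show "\<exists>u. \<forall>\<pi>\<in>\<P>. \<pi> u \<in> Elt ` D (l M) (s (l M))" using Fs that unfolding l_def by blast
  qed
  have inj: "M = M'" if "l M = l M'" for M M' using that by (simp add: l_def)
  have "\<exists>M\<in>N. l M \<notin> F \<and> D (l M) (s (l M)) \<inter> Z = {}"
  proof (rule ccontr)
    assume "\<not> ?thesis"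
    \<comment> \<open>Every member of \<open>F\<close>, and by disjointness every element of
      \<open>Z\<close>, rules out at most one \<open>M\<close>, whereas \<open>N\<close> is
      infinite.\<close>
    then have "N \<subseteq> (\<Union>k\<in>F. {M \<in> N. l M = k}) \<union> (\<Union>z\<in>Z. {M \<in> N. z \<in> D (l M) (s (l M))})" by blast
    moreover have "finite {M \<in> N. l M = k}" for k
    proof (rule finite_subset)
      show "{M \<in> N. l M = k} \<subseteq> {THE M. l M = k}" using inj by (auto intro!: the_equality[symmetric])
    qed simp
    moreover have "finite {M \<in> N. z \<in> D (l M) (s (l M))}" for z
    proof (cases "\<exists>M0\<in>N. z \<in> D (l M0) (s (l M0))")
      case True
      then obtain M0 where M0: "M0 \<in> N" "z \<in> D (l M0) (s (l M0))" by blast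
      have "M = M0" if "M \<in> N" "z \<in> D (l M) (s (l M))" for M
        using disj l(1)[OF that(1)] l(1)[OF M0(1)] that(2) M0(2) inj by blast
      then have "{M \<in> N. z \<in> D (l M) (s (l M))} \<subseteq> {M0}" by blast
      then show ?thesis by (rule finite_subset) simp
    next
      case False
      then have "{M \<in> N. z \<in> D (l M) (s (l M))} = {}" by blast
      then show ?thesis by (simp only: finite.emptyI)
    qed
    ultimately have "finite N" using fin by (meson finite_UN finite_Un finite_subset)
    then show False by (simp add: N_def infinite_Ici)
  qed
  then show ?thesis using l by blast
qed

lemma not_large_Union: "finite F \<Longrightarrow> (\<And>C. C \<in> F \<Longrightarrow> \<not> large C) \<Longrightarrow> \<not> large (\<Union>F)"
proof (induction F rule: finite_induct)
  case empty
  then show ?case by (simp add: not_large_empty)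
next
  case (insert C F)
  then have "\<not> large C" "\<not> large (\<Union>F)" by blast+
  then have "\<not> large (C \<union> \<Union>F)" using large_Un[of C "\<Union>F"] by blast
  then show ?case by simp
qed

definition large_ultras :: "('i \<Rightarrow> 'a::ab_semigroup_add set) \<Rightarrow> 'i set \<Rightarrow> 'a set set set" where
  "large_ultras E L = {p. ultra p \<and> (\<forall>F. finite F \<longrightarrow> tail_sums E L F \<in> p) \<and> (\<forall>B\<in>p. large B)}"

text \<open>A finite union of sets that are not large is not large, so the complements of all such
  sets can be joined to the tails. \<open>N\<close> lists further sets to avoid: none for mere
  existence, the fibres of translation by \<open>e\<close> for non-principality.\<close>

lemma large_ultras_avoiding:
  assumes "\<And>F N'. finite F \<Longrightarrow> finite N' \<Longrightarrow> N' \<subseteq> N \<Longrightarrow> large (tail_sums E L F - \<Union>N')"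
  shows "\<exists>p\<in>large_ultras E L. \<forall>C\<in>N. C \<notin> p"
proof -
  define K where "K = tail_sums E L ` {F. finite F} \<union> uminus ` (N \<union> {C. \<not> large C})"
  have "fip K"
    unfolding fip_def
  proof (intro allI impI notI)
    fix G assume G: "finite G" "G \<subseteq> K" and empty: "\<Inter>G = {}"
    have "finite (G \<inter> tail_sums E L ` {F. finite F})" using G(1) by (intro finite_Int disjI1)
    from finite_subset_image[OF this Int_lower2] obtain R where
      R: "R \<subseteq> {F. finite F}" "finite R" "G \<inter> tail_sums E L ` {F. finite F} = tail_sums E L ` R"
      by (elim exE conjE)
    define N' where "N' = N \<inter> uminus ` G"
    define L' where "L' = {C. \<not> large C} \<inter> uminus ` G"
    have fin: "finite (\<Union>R)" "finite N'" "finite L'" using R(1,2) G(1) by (auto simp: N'_def L'_def)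
    have "tail_sums E L (\<Union>R) - \<Union>N' - \<Union>L' \<subseteq> A" if A: "A \<in> G" for A
    proof -
      consider (tail) "A \<in> tail_sums E L ` R" | (neg) C where "A = - C" "C \<in> N \<union> {C. \<not> large C}"
      proof -
        from G(2) A have "A \<in> K" by blast
        then consider "A \<in> tail_sums E L ` {F. finite F}" | "A \<in> uminus ` (N \<union> {C. \<not> large C})"
          unfolding K_def by (rule UnE)
        then show thesis
        proof cases
          case 1
          then have "A \<in> tail_sums E L ` R" unfolding R(3)[symmetric] using A by simp
          then show thesis by (rule tail)
        next
          case 2
          then show thesis using neg by blast
        qed
      qed
      then show ?thesis
      proof cases
        case tail
        then obtain F where "F \<in> R" "A = tail_sums E L F" by blast
        then show ?thesis using tail_sums_antimono[of F "\<Union>R" E L] by blast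
      next
        case neg
        then have "C \<in> uminus ` G" using A by (metis boolean_algebra_class.boolean_algebra.double_compl imageI)
        then have "C \<in> N' \<union> L'" using neg(2) by (auto simp: N'_def L'_def)
        then show ?thesis using neg(1) by blast
      qed
    qed
    then have "tail_sums E L (\<Union>R) - \<Union>N' - \<Union>L' \<subseteq> \<Inter>G" by blast
    then have "tail_sums E L (\<Union>R) - \<Union>N' \<subseteq> \<Union>L'" using empty by blast
    moreover have "large (tail_sums E L (\<Union>R) - \<Union>N')" using fin by (intro assms) (auto simp: N'_def)
    ultimately have "large (\<Union>L')" by (rule large_mono[rotated])
    then show False using not_large_Union[OF fin(3)] by (auto simp: L'_def)
  qed
  then obtain p where p: "ultra p" "K \<subseteq> p" using ultra_exists by blast
  have "large B" if "B \<in> p" for B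
  proof (rule ccontr)
    assume "\<not> large B"
    then have "- B \<in> p" using p(2) unfolding K_def by blast
    then show False using that ultra_Compl[OF p(1)] by blast
  qed
  moreover have "C \<notin> p" if "C \<in> N" for C
  proof -
    have "- C \<in> p" using that p(2) unfolding K_def by blast
    then show ?thesis using ultra_Compl[OF p(1)] by blast
  qed
  moreover have "tail_sums E L F \<in> p" if "finite F" for F using that p(2) unfolding K_def by blast
  ultimately show ?thesis using p(1) unfolding large_ultras_def by blast
qed

lemma closed_large_ultras: "closed_ultra (large_ultras E L)"
proof (rule closed_ultraI)
  show "ultra p" if "p \<in> large_ultras E L" for p using that by (simp add: large_ultras_def)
  fix p assume p: "ultra p" and *: "\<And>B. B \<in> p \<Longrightarrow> \<exists>q\<in>large_ultras E L. B \<in> q"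
  have "tail_sums E L F \<in> p" if "finite F" for F
  proof (rule ccontr)
    assume "tail_sums E L F \<notin> p"
    then have "- tail_sums E L F \<in> p" using ultra_Compl[OF p] by blast
    then obtain q where "q \<in> large_ultras E L" "- tail_sums E L F \<in> q" using * by blast
    then show False using that ultra_Compl by (auto simp: large_ultras_def)
  qed
  moreover have "large B" if "B \<in> p" for B using *[OF that] by (auto simp: large_ultras_def)
  ultimately show "p \<in> large_ultras E L" using p by (simp add: large_ultras_def)
qed

text \<open>Largeness passes to the sum because points are additive: with \<open>\<pi> u\<close>
  among the good translations for \<open>q\<close>, and \<open>\<pi> v\<close> in the finitely many
  translated sets, \<open>\<pi> (u + v)\<close> lies in \<open>B\<close>.\<close>

lemma uadd_large_ultras:
  assumes p: "p \<in> large_ultras E L" and q: "q \<in> large_ultras E L"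
  shows "uadd p q \<in> large_ultras E L"
proof -
  have up: "ultra p" and uq: "ultra q" using p q by (simp_all add: large_ultras_def)
  have "tail_sums E L F \<in> uadd p q" if F: "finite F" for F
  proof -
    have "{y. x + y \<in> tail_sums E L F} \<in> q" if x: "x \<in> tail_sums E L F" for x
    proof -
      obtain F' where F': "finite F'" "\<forall>y\<in>tail_sums E L (F \<union> F'). x + y \<in> tail_sums E L F"
        using tail_sums_add[OF x] by blast
      have "tail_sums E L (F \<union> F') \<in> q" using q F F'(1) by (simp add: large_ultras_def)
      then show ?thesis by (rule ultra_mono[OF uq]) (use F'(2) in blast)
    qed
    moreover have "tail_sums E L F \<in> p" using p F by (simp add: large_ultras_def)
    ultimately have "{x. {y. x + y \<in> tail_sums E L F} \<in> q} \<in> p"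
      by (elim ultra_mono[OF up]) blast
    then show ?thesis by (simp add: uadd_def)
  qed
  moreover have "large B" if B: "B \<in> uadd p q" for B
    unfolding large_def
  proof (intro allI impI)
    fix m and c :: "'a \<Rightarrow> 'a" and \<P>
    assume c: "c \<in> center_End" and \<P>: "finite \<P>" "\<P> \<subseteq> points m c"
    have "{x. {y. x + y \<in> B} \<in> q} \<in> p" using B by (simp add: uadd_def)
    then have "large {x. {y. x + y \<in> B} \<in> q}" using p by (simp add: large_ultras_def)
    then obtain u where u: "\<forall>\<pi>\<in>\<P>. \<pi> u \<in> Elt ` {x. {y. x + y \<in> B} \<in> q}" using largeD[OF _ c \<P>] by blast
    define B' where "B' = (\<Inter>\<pi>\<in>\<P>. {y. elt (\<pi> u) + y \<in> B})"
    have "B' \<in> q" unfolding B'_def using u by (intro ultra_INT[OF uq \<P>(1)]) auto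
    then have "large B'" using q by (simp add: large_ultras_def)
    then obtain v where v: "\<forall>\<pi>\<in>\<P>. \<pi> v \<in> Elt ` B'" using largeD[OF _ c \<P>] by blast
    have "\<pi> (u + v) \<in> Elt ` B" if \<pi>: "\<pi> \<in> \<P>" for \<pi>
    proof -
      have "\<pi> u \<noteq> 0" using points_neq_0 \<P>(2) \<pi> by blast
      then have "\<pi> u = Elt (elt (\<pi> u))" by simp
      moreover obtain y where "\<pi> v = Elt y" "elt (\<pi> u) + y \<in> B" using v \<pi> unfolding B'_def by blast
      moreover have "\<pi> (u + v) = \<pi> u + \<pi> v"
        using points_add_hom[OF subsetD[OF \<P>(2) \<pi>] center_add_hom[OF c]] by (rule add_homD)
      ultimately show ?thesis by (metis Elt_add imageI)
    qed
    then show "\<exists>u. \<forall>\<pi>\<in>\<P>. \<pi> u \<in> Elt ` B" by blast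
  qed
  ultimately show ?thesis using ultra_uadd[OF up uq] by (simp add: large_ultras_def)
qed

text \<open>For an idempotent \<open>e\<close>, each \<open>Elt e + \<pi>\<close> is again a point.
  Realising it together with \<open>\<pi>\<close> in a set \<open>D\<close> disjoint from a finite
  \<open>Z\<close> gives values \<open>y\<close> with \<open>e + y\<close> outside \<open>Z\<close>,
  as the criterion for non-principality demands.\<close>

lemma system_idempotent:
  fixes s :: "'a::ab_semigroup_add shape \<Rightarrow> 'a list"
  assumes s: "\<forall>l\<in>Lambda_t. s l \<in> pow_carrier (fst l + 1)"
    and disj: "\<forall>l1\<in>Lambda_t. \<forall>l2\<in>Lambda_t. l1 \<noteq> l2 \<longrightarrow> D l1 (s l1) \<inter> D l2 (s l2) = {}"
  defines "E \<equiv> \<lambda>l. D l (s l)"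
  shows "\<exists>p\<in>large_ultras E Lambda_t. uadd p p = p \<and> (\<forall>x. {x} \<notin> p)"
proof (rule nonprincipal_idempotent_exists[OF closed_large_ultras _ uadd_large_ultras])
  note realize = system_realizes_points[OF s disj]
  have tail: "E l \<subseteq> tail_sums E Lambda_t F" if "l \<in> Lambda_t - F" for l F
    using that by (rule subset_tail_sums)
  have "large (tail_sums E Lambda_t F)" if F: "finite F" for F :: "'a shape set"
    unfolding large_def
  proof (intro allI impI)
    fix m and c :: "'a \<Rightarrow> 'a" and \<P> assume "c \<in> center_End" "finite \<P>" "\<P> \<subseteq> points m c"
    from realize[OF this F finite.emptyI]
    show "\<exists>u. \<forall>\<pi>\<in>\<P>. \<pi> u \<in> Elt ` tail_sums E Lambda_t F"
      using tail unfolding E_def by (meson image_mono subset_iff)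
  qed
  then have "\<exists>p\<in>large_ultras E Lambda_t. \<forall>C\<in>{}. C \<notin> p"
    by (intro large_ultras_avoiding) simp
  then show "large_ultras E Lambda_t \<noteq> {}" by blast
  fix e :: 'a assume e: "e + e = e"
  have "\<exists>p\<in>large_ultras E Lambda_t. \<forall>C\<in>range (\<lambda>z. {y. e + y = z}). C \<notin> p"
  proof (rule large_ultras_avoiding)
    fix F :: "'a shape set" and N' assume F: "finite F" and N': "finite N'" "N' \<subseteq> range (\<lambda>z. {y. e + y = z})"
    from finite_subset_image[OF N'] obtain Z where Z: "finite Z" "N' = (\<lambda>z. {y. e + y = z}) ` Z"
      by (elim exE conjE)
    show "large (tail_sums E Lambda_t F - \<Union>N')"
      unfolding large_def
    proof (intro allI impI)
      fix m and c :: "'a \<Rightarrow> 'a" and \<P> assume c: "c \<in> center_End" and \<P>: "finite \<P>" "\<P> \<subseteq> points m c"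
      have "(\<lambda>u. Elt e + \<pi> u) \<in> points m c" if "\<pi> \<in> \<P>" for \<pi>
      proof -
        have "\<pi> \<in> points m c" using \<P>(2) that by blast
        then obtain k \<phi> where k: "k < m" "\<phi> \<in> prefix_hom k" "\<pi> = (\<lambda>u. \<phi> u + Elt (c (u k)))"
          by (rule pointsE)
        have "(\<lambda>_. Elt e) \<in> prefix_hom k"
          using e by (simp add: prefix_hom_def add_hom_def Elt_add[symmetric])
        from pointsI[OF k(1) prefix_hom_add[OF this k(2)], of c] show ?thesis
          by (simp add: k(3) add.assoc)
      qed
      then have sub: "\<P> \<union> (\<lambda>\<pi> u. Elt e + \<pi> u) ` \<P> \<subseteq> points m c" using \<P>(2) by blast
      have fin: "finite (\<P> \<union> (\<lambda>\<pi> u. Elt e + \<pi> u) ` \<P>)" using \<P>(1) by simp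
      from realize[OF c fin sub F Z(1)] obtain l u where l: "l \<in> Lambda_t - F" "D l (s l) \<inter> Z = {}"
        and u: "\<forall>\<pi>\<in>\<P> \<union> (\<lambda>\<pi> u. Elt e + \<pi> u) ` \<P>. \<pi> u \<in> Elt ` D l (s l)"
        by (elim bexE conjE exE)
      have "\<pi> u \<in> Elt ` (tail_sums E Lambda_t F - \<Union>N')" if \<pi>: "\<pi> \<in> \<P>" for \<pi>
      proof -
        have "\<pi> u \<in> Elt ` D l (s l)" using u \<pi> by simp
        then obtain y where y: "\<pi> u = Elt y" "y \<in> D l (s l)" by (rule imageE)
        have "(\<lambda>u. Elt e + \<pi> u) \<in> \<P> \<union> (\<lambda>\<pi> u. Elt e + \<pi> u) ` \<P>" using \<pi> by blast
        from bspec[OF u this] have "Elt e + \<pi> u \<in> Elt ` D l (s l)" .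
        then have "Elt (e + y) \<in> Elt ` D l (s l)" by (simp only: y(1) Elt_add)
        then have "e + y \<in> D l (s l)" by blast
        then have "y \<notin> \<Union>N'" using l(2) by (auto simp: Z(2))
        moreover have "y \<in> tail_sums E Lambda_t F" using tail[OF l(1)] y(2) by (auto simp: E_def)
        ultimately show ?thesis using y(1) by blast
      qed
      then show "\<exists>u. \<forall>\<pi>\<in>\<P>. \<pi> u \<in> Elt ` (tail_sums E Lambda_t F - \<Union>N')" by blast
    qed
  qed
  then show "\<exists>p\<in>large_ultras E Lambda_t. \<forall>z. {y. e + y = z} \<notin> p" by blast
qed

text \<open>Idempotency says that for \<open>C\<close> in \<open>p\<close> the \<open>x\<close>
  whose translates \<open>{y. x + y \<in> C}\<close> lie in \<open>p\<close> form a member of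
  \<open>p\<close>. It is used for \<open>B\<close> and then for the translate of \<open>B\<close>
  by an element of \<open>B'\<close>.\<close>

lemma idempotent_star:
  assumes p: "ultra p" "uadd p p = p" and B: "B \<in> p"
  defines "B' \<equiv> {x \<in> B. {y. x + y \<in> B} \<in> p}"
  shows "B' \<in> p" "\<And>x. x \<in> B' \<Longrightarrow> {y. x + y \<in> B'} \<in> p"
proof -
  have shift: "{x. {y. x + y \<in> C} \<in> p} \<in> p" if "C \<in> p" for C
  proof -
    have "C \<in> uadd p p" using that p(2) by simp
    then show ?thesis by (simp add: uadd_def)
  qed
  have "B' = B \<inter> {x. {y. x + y \<in> B} \<in> p}" by (auto simp: B'_def)
  then show "B' \<in> p" using ultra_Int[OF p(1) B shift[OF B]] by simp
  fix x assume "x \<in> B'"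
  then have x: "{y. x + y \<in> B} \<in> p" by (simp add: B'_def)
  have "{y. x + y \<in> B'} = {y. x + y \<in> B} \<inter> {y. {z. y + z \<in> {y. x + y \<in> B}} \<in> p}"
    by (auto simp: B'_def add.assoc)
  then show "{y. x + y \<in> B'} \<in> p" using ultra_Int[OF p(1) x shift[OF x]] by simp
qed

text \<open>The shapes are treated one after another. The next \<open>D\<close> is chosen inside
  \<open>B'\<close> and the translates of \<open>B'\<close> by all earlier sums, so that new sums
  stay in \<open>B'\<close>. It also avoids the finite set of earlier sums, whose complement is in
  \<open>p\<close> by non-principality.\<close>

lemma system_in_idempotent_member:
  assumes p: "ultra p" "uadd p p = p" "\<And>x. {x} \<notin> p" and lg: "\<And>C. C \<in> p \<Longrightarrow> large C"
    and B: "B \<in> p" and L: "countable (Lambda_t :: 'a::ab_semigroup_add shape set)"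
    and ne: "(Lambda_t :: 'a shape set) \<noteq> {}"
  shows "is_system Lambda_t (B :: 'a set)"
proof -
  define B' where "B' = {x \<in> B. {y. x + y \<in> B} \<in> p}"
  note star = idempotent_star[OF p(1,2) B, folded B'_def]
  define sh where "sh = from_nat_into (Lambda_t :: 'a shape set)"
  have sh: "sh n \<in> Lambda_t" for n using from_nat_into[OF ne] by (simp add: sh_def)
  have step: "\<exists>t. length t = Suc (fst l) \<and> D l t \<subseteq> B' \<and> D l t \<inter> Y = {} \<and> (\<forall>y\<in>Y. \<forall>d\<in>D l t. y + d \<in> B')"
    if l: "l \<in> Lambda_t" and Y: "finite Y" "Y \<subseteq> B'" for l Y
  proof -
    have "(\<Inter>y\<in>Y. {z. y + z \<in> B'}) \<in> p" using star(2) Y by (intro ultra_INT[OF p(1)]) auto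
    moreover have "- Y \<in> p"
    proof -
      have "\<Union>((\<lambda>y. {y}) ` Y) \<notin> p" using ultra_Union[OF _ p(1), of "(\<lambda>y. {y}) ` Y"] Y(1) p(3) by blast
      then show ?thesis using ultra_Compl[OF p(1)] by simp
    qed
    ultimately have "B' \<inter> ((\<Inter>y\<in>Y. {z. y + z \<in> B'}) \<inter> - Y) \<in> p" using star(1) ultra_Int[OF p(1)] by blast
    then have C: "large (B' \<inter> ((\<Inter>y\<in>Y. {z. y + z \<in> B'}) \<inter> - Y))" by (rule lg)
    obtain m F c where mFc: "l = (m, F, c)" by (cases l)
    obtain t where "length t = Suc m" "D l t \<subseteq> B' \<inter> ((\<Inter>y\<in>Y. {z. y + z \<in> B'}) \<inter> - Y)"
      using large_D_subset[OF C l[unfolded mFc]] unfolding mFc by (elim exE conjE)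
    then have "length t = Suc (fst l) \<and> D l t \<subseteq> B' \<and> D l t \<inter> Y = {} \<and>
        (\<forall>y\<in>Y. \<forall>d\<in>D l t. y + d \<in> B')"
      unfolding mFc fst_conv by blast
    then show ?thesis ..
  qed
  \<comment> \<open>The second component of \<open>f n\<close> holds all sums formed before step
    \<open>n\<close>; the first component of \<open>f (Suc n)\<close> is the tuple chosen for
    \<open>sh n\<close>, and that of \<open>f 0\<close> is a dummy.\<close>
  have "\<exists>f. \<forall>n. (finite (snd (f n)) \<and> snd (f n) \<subseteq> B') \<and>
    (length (fst (f (Suc n))) = Suc (fst (sh n)) \<and> D (sh n) (fst (f (Suc n))) \<inter> snd (f n) = {} \<and>
     snd (f (Suc n)) = snd (f n) \<union> D (sh n) (fst (f (Suc n))) \<union>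
       (\<lambda>(y, d). y + d) ` (snd (f n) \<times> D (sh n) (fst (f (Suc n)))))"
  proof (rule dependent_nat_choice)
    show "\<exists>x :: 'a list \<times> 'a set. finite (snd x) \<and> snd x \<subseteq> B'" by (rule exI[of _ "([], {})"]) simp
    fix x :: "'a list \<times> 'a set" and n assume x: "finite (snd x) \<and> snd x \<subseteq> B'"
    from step[OF sh this[THEN conjunct1] this[THEN conjunct2], of n] obtain t where t: "length t = Suc (fst (sh n))"
      "D (sh n) t \<subseteq> B'" "D (sh n) t \<inter> snd x = {}" "\<forall>y\<in>snd x. \<forall>d\<in>D (sh n) t. y + d \<in> B'"
      by blast
    have "finite (D (sh n) t)" using sh[of n] finite_D by (cases "sh n") auto
    then show "\<exists>y. (finite (snd y) \<and> snd y \<subseteq> B') \<and> length (fst y) = Suc (fst (sh n)) \<and>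
        D (sh n) (fst y) \<inter> snd x = {} \<and> snd y = snd x \<union> D (sh n) (fst y) \<union>
          (\<lambda>(y, d). y + d) ` (snd x \<times> D (sh n) (fst y))"
      using t x
      by (intro exI[of _ "(t, snd x \<union> D (sh n) t \<union> (\<lambda>(y, d). y + d) ` (snd x \<times> D (sh n) t))"]) auto
  qed
  then obtain f where f_all: "\<forall>n. (finite (snd (f n)) \<and> snd (f n) \<subseteq> B') \<and>
    (length (fst (f (Suc n))) = Suc (fst (sh n)) \<and> D (sh n) (fst (f (Suc n))) \<inter> snd (f n) = {} \<and>
     snd (f (Suc n)) = snd (f n) \<union> D (sh n) (fst (f (Suc n))) \<union>
       (\<lambda>(y, d). y + d) ` (snd (f n) \<times> D (sh n) (fst (f (Suc n)))))" by (rule exE)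
  have f: "snd (f n) \<subseteq> B'" "length (fst (f (Suc n))) = Suc (fst (sh n))"
      "D (sh n) (fst (f (Suc n))) \<inter> snd (f n) = {}"
    and f_Suc: "snd (f (Suc n)) = snd (f n) \<union> D (sh n) (fst (f (Suc n))) \<union>
       (\<lambda>(y, d). y + d) ` (snd (f n) \<times> D (sh n) (fst (f (Suc n))))" for n
    using spec[OF f_all, of n] by blast+
  define Y where "Y n = snd (f n)" for n
  define idx where "idx = to_nat_on (Lambda_t :: 'a shape set)"
  define s where "s l = fst (f (Suc (idx l)))" for l
  have idx: "sh (idx l) = l" if "l \<in> Lambda_t" for l
    using that L by (simp add: sh_def idx_def)
  have len: "length (s l) = Suc (fst l)" if "l \<in> Lambda_t" for l
    using f(2)[of "idx l"] idx[OF that] by (simp add: s_def)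
  have disj0: "D l (s l) \<inter> Y (idx l) = {}" if "l \<in> Lambda_t" for l
    using f(3)[of "idx l"] idx[OF that] by (simp add: s_def Y_def)
  have Y_Suc: "Y (Suc (idx l)) = Y (idx l) \<union> D l (s l) \<union> (\<lambda>(y, d). y + d) ` (Y (idx l) \<times> D l (s l))"
    if "l \<in> Lambda_t" for l
    using f_Suc[of "idx l"] idx[OF that] by (simp add: s_def Y_def)
  have Y_mono: "Y n \<subseteq> Y n'" if "n \<le> n'" for n n'
    using that by (rule lift_Suc_mono_le[rotated]) (auto simp: Y_def f_Suc)
  have disj: "D l1 (s l1) \<inter> D l2 (s l2) = {}" if l: "l1 \<in> Lambda_t" "l2 \<in> Lambda_t" "idx l1 < idx l2" for l1 l2
    using Y_Suc[OF l(1)] Y_mono[of "Suc (idx l1)" "idx l2"] l(3) disj0[OF l(2)] by auto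
  \<comment> \<open>Induction on the bound for the indices: the shape with index \<open>n\<close>,
    if present, is split off. A set consisting of it alone is treated separately, as there is no
    empty sum.\<close>
  have sums: "nsum a I \<in> Y n"
    if "finite I" "I \<noteq> {}" "I \<subseteq> Lambda_t" "\<forall>l\<in>I. a l \<in> D l (s l)" "\<forall>l\<in>I. idx l < n" for a I n
    using that
  proof (induction n arbitrary: I)
    case (Suc n)
    show ?case
    proof (cases "\<exists>l\<in>I. idx l = n")
      case False
      then have "\<forall>l\<in>I. idx l < n" using Suc.prems(5) by (metis less_SucE)
      then have "nsum a I \<in> Y n" using Suc.IH Suc.prems by blast
      then show ?thesis using Y_mono[of n "Suc n"] by auto
    next
      case True
      then obtain l where l: "l \<in> I" "idx l = n" by blast
      have lL: "l \<in> Lambda_t" using l(1) Suc.prems(3) by blast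
      have al: "a l \<in> D l (s l)" using l(1) Suc.prems(4) by blast
      have other: "idx l' < n" if "l' \<in> I - {l}" for l'
      proof -
        have "idx l' \<noteq> idx l" using idx[of l'] idx[OF lL] that Suc.prems(3) by auto
        then show ?thesis using that Suc.prems(5) l(2) by (auto simp: less_Suc_eq)
      qed
      show ?thesis
      proof (cases "I - {l} = {}")
        case True
        then have "I = {l}" using l(1) by blast
        then show ?thesis using Y_Suc[OF lL] al l(2) by simp
      next
        case False
        have "nsum a (I - {l}) \<in> Y n"
          using Suc.prems False other by (intro Suc.IH) auto
        moreover have "nsum a I = a l + nsum a (I - {l})"
          using nsum_insert[of "I - {l}" l a] Suc.prems(1) False l(1) by (simp add: insert_absorb)
        ultimately show ?thesis
          using Y_Suc[OF lL] al l(2) by (auto simp: add.commute intro!: image_eqI[of _ _ "(nsum a (I - {l}), a l)"])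
      qed
    qed
  qed auto
  show ?thesis
    unfolding is_system_def
  proof (intro exI[of _ s] conjI ballI allI impI)
    show "s l \<in> pow_carrier (fst l + 1)" if "l \<in> Lambda_t" for l
      using len[OF that] by (simp add: pow_carrier_def)
    show "D l1 (s l1) \<inter> D l2 (s l2) = {}" if l: "l1 \<in> Lambda_t" "l2 \<in> Lambda_t" "l1 \<noteq> l2" for l1 l2
    proof -
      have "idx l1 \<noteq> idx l2" using idx l by metis
      then consider "idx l1 < idx l2" | "idx l2 < idx l1" by linarith
      then show ?thesis
      proof cases
        case 1
        then show ?thesis by (rule disj[OF l(1,2)])
      next
        case 2
        then show ?thesis using disj[OF l(2,1)] by (simp add: Int_commute)
      qed
    qed
    fix I :: "'a shape set" assume I: "finite I \<and> I \<noteq> {} \<and> I \<subseteq> Lambda_t"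
    have "nsum a I \<in> B" if a: "\<forall>l\<in>I. a l \<in> D l (s l)" for a
    proof -
      have "\<forall>l\<in>I. idx l < Suc (Max (idx ` I))" using I by (simp add: less_Suc_eq_le)
      then have "nsum a I \<in> Y (Suc (Max (idx ` I)))" using I a by (intro sums) auto
      then show ?thesis using f(1) by (auto simp: Y_def B'_def)
    qed
    then show "sum_sets (\<lambda>l. D l (s l)) I \<subseteq> B" by (auto simp: sum_sets_def)
  qed
qed

theorem theorem3p20:
  fixes A :: "'a::ab_semigroup_add set" and P :: "'a set set"
  assumes "countable (UNIV :: 'a set)"
    and "countable (Lambda_t :: 'a shape set)"
    and "is_system Lambda_t A"
    and "finite P" and "partition_on A P"
  shows "\<exists>B\<in>P. is_system Lambda_t B"
proof -
  obtain s where s: "\<forall>l\<in>Lambda_t. s l \<in> pow_carrier (fst l + 1)"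
    and disj: "\<forall>l1\<in>Lambda_t. \<forall>l2\<in>Lambda_t. l1 \<noteq> l2 \<longrightarrow> D l1 (s l1) \<inter> D l2 (s l2) = {}"
    and sums: "\<forall>I. finite I \<and> I \<noteq> {} \<and> I \<subseteq> Lambda_t \<longrightarrow> sum_sets (\<lambda>l. D l (s l)) I \<subseteq> A"
    using assms(3) unfolding is_system_def by (elim exE conjE)
  obtain p where p: "p \<in> large_ultras (\<lambda>l. D l (s l)) Lambda_t" "uadd p p = p" "\<forall>x. {x} \<notin> p"
    using system_idempotent[OF s disj] by blast
  have up: "ultra p" and lg: "\<And>C. C \<in> p \<Longrightarrow> large C"
    and tail: "tail_sums (\<lambda>l. D l (s l)) Lambda_t {} \<in> p"
    using p(1) by (simp_all add: large_ultras_def)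
  have sub: "tail_sums (\<lambda>l. D l (s l)) Lambda_t {} \<subseteq> A" using sums by (auto simp: tail_sums_def)
  \<comment> \<open>The sums over all shapes lie in \<open>A\<close>, so \<open>A\<close> belongs to
    the idempotent and one of its finitely many cells does.\<close>
  have "\<Union>P \<in> p" using ultra_mono[OF up tail sub] assms(5) by (simp add: partition_on_def)
  then obtain B where B: "B \<in> P" "B \<in> p" using ultra_Union[OF assms(4) up] by blast
  have ne: "(Lambda_t :: 'a shape set) \<noteq> {}"
    using tail ultra_not_empty[OF up] by (auto simp: tail_sums_def)
  have "is_system Lambda_t B"
    using system_in_idempotent_member[OF up p(2) _ lg B(2) assms(2) ne] p(3) by blast
  then show ?thesis using B(1) by blast
qed

end
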